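(* Let $n\ge 1$ and let $(\mathcal O,\mathcal C)$, $\mathcal O,\mathcal C\subseteq[n]$, be an opener-closer configuration. Then there exists a non-crossing set partition $\mathcal B$ of type $D_n$ with $\operatorname{op}(\mathcal B)=\mathcal O$ and $\operatorname{cl}(\mathcal B)=\mathcal C$ if and only if $$|\mathcal O|-|\mathcal C|\text{ is even}\quad\text{or}\quad n\in\mathcal O\cap\mathcal C.$$ Moreover, if both of these conditions hold (that is, $|\mathcal O|-|\mathcal C|$ is even and $n\in\mathcal O\cap\mathcal C$), there exist exactly two non-crossing set partitions of type $D_n$ having this opener-closer configuration; otherwise (if exactly one of the two conditions holds) it is unique.
   Context: Let $[n]=\{1,\dots,n\}$ (with $[0]=\emptyset$) and $[\pm n]=\{1,\dots,n,-1,\dots,-n\}$. A set partition of type $C_n$ is a set partition $\mathcal B$ of $[\pm n]$ such that $B\in\mathcal B\Leftrightarrow -B\in\mathcal B$ and such that there is at most one block $B_0$ (the zero block) with $B_0=-B_0$. A set partition of type $D_n$ is a set partition of type $C_n$ whose zero block, if present, does not consist of a single pair $\{i,-i\}$. An opener-closer configuration is a pair $(\mathcal O,\mathcal C)$ of subsets of $[n]$ with $|\mathcal O\cap[k]|\ge|\mathcal C\cap[k+1]|$ for all $k\in\{0,1,\dots,n-1\}$ (it is not required that $|\mathcal O|=|\mathcal C|$). The nesting order is $1<2<\dots<n<-n<\dots<-2<-1$; the crossing order is $1<2<\dots<n<-1<-2<\dots<-n$. The arcs of $\mathcal B$ are the pairs $(i,j)$ where $i$ and $j$ are consecutive elements of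 a block with respect to the nesting order, $i$ preceding $j$. Two arcs cross if their endpoint sets can be written $\{a,b\}$, $\{a',b'\}$ with $a<a'<b<b'$ in the crossing order. The openers $\operatorname{op}(\mathcal B)$ are the positive elements not maximal in their block, and the closers $\operatorname{cl}(\mathcal B)$ are the positive elements not minimal in their block, both with respect to the nesting order. Let $\mathcal B$ be a set partition of type $D_n$ and let $(i_1,-j_1),\dots,(i_k,-j_k)$, with $0<i_l,j_l<n$ and $i_1<\dots<i_k$, be all arcs of $\mathcal B$ that start in $\{1,\dots,n-1\}$ and end in $\{-1,\dots,-(n-1)\}$. $\mathcal B$ is called non-crossing if (i) whenever $(i,-i)$ is an arc of $\mathcal B$ then $i=n$; and if no two arcs of $\mathcal B$ cross, with the following exceptions: (ii) arcs containing $n$ must cross all arcs $(i_l,-j_l)$ with $l>k/2$; (iii) arcs containing $-n$ must cross all arcs $(i_l,-j_l)$ with $l\le k/2$; (iv) two arcs, one containing $n$ and the other containing $-n$, may cross. (Crossings not mentioned in (ii)-(iv) are not allowed. Under these conditions $k$ is automatically even.) *)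

theory Defs
  imports Main "HOL-Library.Disjoint_Sets"
begin

text \<open>The set $[\pm n]$ consists of the nonzero integers of absolute value at most $n$;
  subsets of $[n]$ are represented as sets of positive integers.\<close>

definition pm_set :: "nat \<Rightarrow> int set" where
  "pm_set n = {1..int n} \<union> uminus ` {1..int n}"

definition set_partition_C :: "nat \<Rightarrow> int set set \<Rightarrow> bool" where
  "set_partition_C n P \<longleftrightarrow>
     partition_on (pm_set n) P \<and>
     (\<forall>B. B \<in> P \<longleftrightarrow> uminus ` B \<in> P) \<and>
     (\<forall>B\<in>P. \<forall>B'\<in>P. B = uminus ` B \<and> B' = uminus ` B' \<longrightarrow> B = B')"

definition set_partition_D :: "nat \<Rightarrow> int set set \<Rightarrow> bool" where
  "set_partition_D n P \<longleftrightarrow>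
     set_partition_C n P \<and>
     (\<forall>B\<in>P. B = uminus ` B \<longrightarrow> \<not> (\<exists>i. B = {i, -i}))"

definition opener_closer_config :: "nat \<Rightarrow> int set \<Rightarrow> int set \<Rightarrow> bool" where
  "opener_closer_config n Op Cl \<longleftrightarrow>
     Op \<subseteq> {1..int n} \<and> Cl \<subseteq> {1..int n} \<and>
     (\<forall>k<n. card (Op \<inter> {1..int k}) \<ge> card (Cl \<inter> {1..int (k + 1)}))"

text \<open>$1 < 2 < \dots < n < -n < \dots < -2 < -1$, uniformly in $n$ on nonzero integers.\<close>

definition nesting_less :: "int \<Rightarrow> int \<Rightarrow> bool" where
  "nesting_less x y \<longleftrightarrow> (x > 0 \<and> y < 0) \<or> ((x > 0 \<longleftrightarrow> y > 0) \<and> x < y)"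

text \<open>$1 < 2 < \dots < n < -1 < -2 < \dots < -n$, uniformly in $n$ on nonzero integers.\<close>

definition crossing_less :: "int \<Rightarrow> int \<Rightarrow> bool" where
  "crossing_less x y \<longleftrightarrow> (x > 0 \<and> y < 0) \<or> ((x > 0 \<longleftrightarrow> y > 0) \<and> \<bar>x\<bar> < \<bar>y\<bar>)"

definition arcs :: "int set set \<Rightarrow> (int \<times> int) set" where
  "arcs P = {(i, j). \<exists>B\<in>P. i \<in> B \<and> j \<in> B \<and> nesting_less i j \<and>
                \<not> (\<exists>m\<in>B. nesting_less i m \<and> nesting_less m j)}"

definition ends :: "int \<times> int \<Rightarrow> int set" where
  "ends \<alpha> = {fst \<alpha>, snd \<alpha>}"

definition arcs_cross :: "int \<times> int \<Rightarrow> int \<times> int \<Rightarrow> bool" where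
  "arcs_cross \<alpha> \<beta> \<longleftrightarrow>
     (\<exists>a b a' b'. {ends \<alpha>, ends \<beta>} = {{a, b}, {a', b'}} \<and>
        crossing_less a a' \<and> crossing_less a' b \<and> crossing_less b b')"

definition openers :: "int set set \<Rightarrow> int set" where
  "openers P = {i. i > 0 \<and> (\<exists>B\<in>P. i \<in> B \<and> (\<exists>j\<in>B. nesting_less i j))}"

definition closers :: "int set set \<Rightarrow> int set" where
  "closers P = {i. i > 0 \<and> (\<exists>B\<in>P. i \<in> B \<and> (\<exists>j\<in>B. nesting_less j i))}"

text \<open>The arcs $(i_1,-j_1),\dots,(i_k,-j_k)$ with $0 < i_l, j_l < n$ and $i_1 < \dots < i_k$.
  Distinct arcs have distinct first components, so the position $l$ of $(i_l,-j_l)$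
  in this list is its rank with respect to the first component.\<close>

definition central_arcs :: "nat \<Rightarrow> int set set \<Rightarrow> (int \<times> int) set" where
  "central_arcs n P = {(i, j) \<in> arcs P. 0 < i \<and> i < int n \<and> - int n < j \<and> j < 0}"

definition central_index :: "nat \<Rightarrow> int set set \<Rightarrow> int \<times> int \<Rightarrow> nat" where
  "central_index n P \<alpha> = card {\<beta> \<in> central_arcs n P. fst \<beta> \<le> fst \<alpha>}"

text \<open>The conditions $l > k/2$ and $l \le k/2$ on the arc $(i_l,-j_l)$.\<close>

definition upper_central_arcs :: "nat \<Rightarrow> int set set \<Rightarrow> (int \<times> int) set" where
  "upper_central_arcs n P =
     {\<alpha> \<in> central_arcs n P. 2 * central_index n P \<alpha> > card (central_arcs n P)}"

definition lower_central_arcs :: "nat \<Rightarrow> int set set \<Rightarrow> (int \<times> int) set" where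
  "lower_central_arcs n P =
     {\<alpha> \<in> central_arcs n P. 2 * central_index n P \<alpha> \<le> card (central_arcs n P)}"

definition allowed_crossing :: "nat \<Rightarrow> int set set \<Rightarrow> int \<times> int \<Rightarrow> int \<times> int \<Rightarrow> bool" where
  "allowed_crossing n P \<alpha> \<beta> \<longleftrightarrow>
     (int n \<in> ends \<alpha> \<and> \<beta> \<in> upper_central_arcs n P) \<or>
     (- int n \<in> ends \<alpha> \<and> \<beta> \<in> lower_central_arcs n P) \<or>
     (int n \<in> ends \<alpha> \<and> - int n \<in> ends \<beta>)"

text \<open>The crossings with central arcs are not only permitted but required;
  the crossings between an arc at $n$ and an arc at $-n$ are optional.\<close>

definition noncrossing_D :: "nat \<Rightarrow> int set set \<Rightarrow> bool" where
  "noncrossing_D n P \<longleftrightarrow>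
     set_partition_D n P \<and>
     (\<forall>i. (i, -i) \<in> arcs P \<longrightarrow> i = int n) \<and>
     (\<forall>\<alpha>\<in>arcs P. int n \<in> ends \<alpha> \<longrightarrow> (\<forall>\<beta>\<in>upper_central_arcs n P. arcs_cross \<alpha> \<beta>)) \<and>
     (\<forall>\<alpha>\<in>arcs P. - int n \<in> ends \<alpha> \<longrightarrow> (\<forall>\<beta>\<in>lower_central_arcs n P. arcs_cross \<alpha> \<beta>)) \<and>
     (\<forall>\<alpha>\<in>arcs P. \<forall>\<beta>\<in>arcs P.
        arcs_cross \<alpha> \<beta> \<longrightarrow> allowed_crossing n P \<alpha> \<beta> \<or> allowed_crossing n P \<beta> \<alpha>)"

end

theory Submission
  imports Defs
begin

text \<open>
A partition is determined by its arcs. If it is invariant under negation, its arcs are invariant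
under \<open>(i, j) \<mapsto> (- j, - i)\<close> and are encoded by two relations on the positive elements: \<open>F\<close>
collects the arcs between positive elements, and \<open>G\<close> contains \<open>(i, j)\<close> for every arc \<open>(i, - j)\<close>.
The relation \<open>G\<close> is symmetric, the openers are \<open>Domain F \<union> Domain G\<close>, and the closers are
\<open>Range F\<close>. In the crossing order, arcs of \<open>F\<close> cross as in an ordinary partition, an arc
\<open>(a, b)\<close> of \<open>F\<close> crosses an arc \<open>(i, - j)\<close> iff \<open>a < i < b\<close>, and two arcs \<open>(i, - j)\<close>,
\<open>(i', - j')\<close> with \<open>i < i'\<close> cross iff \<open>j < j'\<close>.

Away from \<open>n\<close> and \<open>- n\<close>, everything is therefore forced. A closer below \<open>n\<close> must be joined to
the most recent opener that is still unmatched; this gives a unique matching \<open>M\<close> below \<open>n\<close>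
(\<open>stack_matching_ex1\<close>), and no opener that it leaves unmatched lies under one of its arcs. The set
\<open>K\<close> of starting points of arcs \<open>(i, - j)\<close> with \<open>i, j < n\<close> is matched with itself in reverse order
(\<open>reversal_unique\<close>). Its size is even, because otherwise its middle element \<open>i\<close> would give an arc
\<open>(i, - i)\<close>.

Only the attachment of \<open>n\<close> is left to choose. Let \<open>U\<close> be the set of openers below \<open>n\<close> that \<open>M\<close>
leaves unmatched. If \<open>n\<close> is a closer, some \<open>x \<in> U\<close> is joined to \<open>n\<close>. If \<open>n\<close> is an opener, either
some \<open>y \<in> U\<close> is joined to \<open>- n\<close>, or \<open>n\<close> is; the latter requires that \<open>n\<close> is a closer as well,
since the zero block must not be \<open>{n, - n}\<close>. The remaining elements of \<open>U\<close> form \<open>K\<close>. The crossings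
required with the upper central arcs and forbidden with the lower ones, or vice versa, say that
\<open>x\<close> and \<open>y\<close> lie between the lower and the upper half of \<open>K\<close>, that is, have as many elements of
\<open>K\<close> below as above (\<open>separates_iff\<close>).

It remains to count. The difference of the numbers of openers and closers is the size of \<open>U\<close>, plus
one if \<open>n\<close> is an opener and minus one if \<open>n\<close> is a closer. If \<open>n\<close> is neither, the size of \<open>K = U\<close>
has to be even; if \<open>n\<close> is only one of the two, the size of \<open>U\<close> has to be odd and its median is attached to \<open>n\<close> or
\<open>- n\<close>. In these cases the difference is even and the solution is unique. If \<open>n\<close> is both and
\<open>U\<close> has odd size, then \<open>n\<close> is joined to \<open>- n\<close> and to the median of \<open>U\<close>. If \<open>n\<close> is both and \<open>U\<close> has
even size, then \<open>x\<close> and \<open>y\<close> are the two middle elements of \<open>U\<close> in either order, which gives the two solutions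
(\<open>attachments_count\<close>).
\<close>

section \<open>Set partitions and their arcs\<close>

lemma nesting_less_trans:
  "nesting_less x y \<Longrightarrow> nesting_less y z \<Longrightarrow> z \<noteq> 0 \<Longrightarrow> nesting_less x z"
  by (auto simp: nesting_less_def)

lemma nesting_less_asym: "nesting_less x y \<Longrightarrow> \<not> nesting_less y x"
  by (auto simp: nesting_less_def)

lemma nesting_less_total:
  "x \<noteq> 0 \<Longrightarrow> y \<noteq> 0 \<Longrightarrow> x \<noteq> y \<Longrightarrow> nesting_less x y \<or> nesting_less y x"
  by (auto simp: nesting_less_def)

lemma nesting_less_uminus:
  "x \<noteq> 0 \<Longrightarrow> y \<noteq> 0 \<Longrightarrow> nesting_less (- x) (- y) \<longleftrightarrow> nesting_less y x"
  by (auto simp: nesting_less_def)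

lemma finite_pm_set: "finite (pm_set n)"
  by (simp add: pm_set_def)

lemma pm_set_iff: "x \<in> pm_set n \<longleftrightarrow> x \<noteq> 0 \<and> \<bar>x\<bar> \<le> int n"
proof
  assume *: "x \<noteq> 0 \<and> \<bar>x\<bar> \<le> int n"
  then have "x \<in> {1..int n} \<or> - x \<in> {1..int n}" by auto
  then show "x \<in> pm_set n" unfolding pm_set_def by (metis Un_iff image_eqI minus_minus)
qed (auto simp: pm_set_def)

text \<open>
An arc is a pair of consecutive elements of a block, so a comparable pair is joined by a
chain of arcs through the elements in between.
\<close>

lemma arcs_trancl:
  assumes "B \<in> P" "finite B" "0 \<notin> B" "x \<in> B" "y \<in> B" "nesting_less x y"
  shows "(x, y) \<in> (arcs P)\<^sup>+"
  using assms(4-6)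
proof (induction "card {m \<in> B. nesting_less x m \<and> nesting_less m y}" arbitrary: x y
    rule: less_induct)
  case less
  show ?case
  proof (cases "\<exists>m\<in>B. nesting_less x m \<and> nesting_less m y")
    case False
    then show ?thesis using less.prems assms(1) by (auto simp: arcs_def)
  next
    case True
    then obtain m where m: "m \<in> B" "nesting_less x m" "nesting_less m y" by blast
    have nz: "m \<noteq> 0" "y \<noteq> 0" using m less.prems assms(3) by auto
    have "m \<in> {k \<in> B. nesting_less x k \<and> nesting_less k y}"
      "m \<notin> {k \<in> B. nesting_less x k \<and> nesting_less k m}"
      "m \<notin> {k \<in> B. nesting_less m k \<and> nesting_less k y}"
      using m nesting_less_asym by auto
    moreover have "{k \<in> B. nesting_less x k \<and> nesting_less k m}
        \<subseteq> {k \<in> B. nesting_less x k \<and> nesting_less k y}"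
      "{k \<in> B. nesting_less m k \<and> nesting_less k y}
        \<subseteq> {k \<in> B. nesting_less x k \<and> nesting_less k y}"
      using m nz assms(3) by (auto intro: nesting_less_trans)
    ultimately have smaller: "card {k \<in> B. nesting_less x k \<and> nesting_less k m}
        < card {k \<in> B. nesting_less x k \<and> nesting_less k y}"
      "card {k \<in> B. nesting_less m k \<and> nesting_less k y}
        < card {k \<in> B. nesting_less x k \<and> nesting_less k y}"
      using assms(2) by (auto intro!: psubset_card_mono)
    have "(x, m) \<in> (arcs P)\<^sup>+" using less.hyps[OF smaller(1)] less.prems m by blast
    moreover have "(m, y) \<in> (arcs P)\<^sup>+" using less.hyps[OF smaller(2)] less.prems m by blast
    ultimately show ?thesis by (rule trancl_trans)
  qed
qed

lemma arcs_nesting_less: "(i, j) \<in> arcs P \<Longrightarrow> nesting_less i j"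
  by (auto simp: arcs_def)

lemma arcs_in_block:
  assumes "partition_on X P" "(i, j) \<in> arcs P" "B \<in> P"
  shows "i \<in> B \<longleftrightarrow> j \<in> B"
  using assms partition_onD2[OF assms(1)] unfolding arcs_def disjoint_def by blast

lemma arcs_in_carrier:
  "partition_on X P \<Longrightarrow> (i, j) \<in> arcs P \<Longrightarrow> i \<in> X \<and> j \<in> X"
  by (auto simp: arcs_def partition_on_def)

lemma single_valued_arcs:
  assumes "partition_on X P" "0 \<notin> X"
  shows "single_valued (arcs P)" and "single_valued ((arcs P)\<inverse>)"
proof -
  have same: "B = C" if "B \<in> P" "C \<in> P" "x \<in> B" "x \<in> C" for B C x
    using that partition_onD2[OF assms(1)] by (auto simp: disjoint_def)
  have nz: "x \<noteq> 0" if "B \<in> P" "x \<in> B" for B x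
    using that assms by (auto simp: partition_on_def)
  show "single_valued (arcs P)"
  proof (rule single_valuedI)
    fix x y z assume "(x, y) \<in> arcs P" "(x, z) \<in> arcs P"
    then show "y = z" unfolding arcs_def using same nz nesting_less_total
      by (smt (verit) case_prodD mem_Collect_eq)
  qed
  show "single_valued ((arcs P)\<inverse>)"
  proof (rule single_valuedI)
    fix x y z assume "(x, y) \<in> (arcs P)\<inverse>" "(x, z) \<in> (arcs P)\<inverse>"
    then show "y = z" unfolding arcs_def using same nz nesting_less_total
      by (smt (verit) case_prodD mem_Collect_eq converseD)
  qed
qed

text \<open>
The arcs of \<open>P\<close> connect each of its blocks, and no arc of \<open>Q\<close> leaves a block of \<open>Q\<close>.
\<close>

lemma blocks_refine_if_arcs_subset:
  assumes P: "partition_on X P" and Q: "partition_on X Q" and "finite X" "0 \<notin> X"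
    and sub: "arcs P \<subseteq> arcs Q" and "B \<in> P"
  shows "\<exists>C\<in>Q. B \<subseteq> C"
proof -
  have BX: "B \<subseteq> X" "B \<noteq> {}" using P \<open>B \<in> P\<close> by (auto simp: partition_on_def)
  have fin: "finite B" "0 \<notin> B" using BX assms(3,4) by (auto intro: finite_subset)
  obtain x where x: "x \<in> B" using BX by blast
  then obtain C where C: "C \<in> Q" "x \<in> C" using BX Q by (auto simp: partition_on_def)
  have step: "a \<in> C \<longleftrightarrow> b \<in> C" if "(a, b) \<in> (arcs P)\<^sup>+" for a b
    using that by induction (use sub C(1) arcs_in_block[OF Q] in blast)+
  have "y \<in> C" if "y \<in> B" for y
  proof (cases "y = x")
    case False
    then have "nesting_less x y \<or> nesting_less y x"
      using x that fin by (metis nesting_less_total)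
    then show ?thesis
      using arcs_trancl[OF \<open>B \<in> P\<close> fin] x that step C(2) by blast
  qed (use C in simp)
  then show ?thesis using C by blast
qed

lemma partition_eq_if_arcs_eq:
  assumes P: "partition_on X P" and Q: "partition_on X Q" and X: "finite X" "0 \<notin> X"
    and eq: "arcs P = arcs Q"
  shows "P = Q"
proof -
  have "P \<subseteq> Q" if P: "partition_on X P" and Q: "partition_on X Q" and eq: "arcs P = arcs Q" for P Q
  proof
    fix B assume B: "B \<in> P"
    obtain C where C: "C \<in> Q" "B \<subseteq> C"
      using blocks_refine_if_arcs_subset[OF P Q X] eq B by blast
    obtain B' where B': "B' \<in> P" "C \<subseteq> B'"
      using blocks_refine_if_arcs_subset[OF Q P X] eq C by blast
    have "B \<noteq> {}" using P B by (auto simp: partition_on_def)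
    then have "B = B'" using partition_onD2[OF P] B B' C unfolding disjoint_def by blast
    then show "B \<in> Q" using B' C by (metis subset_antisym)
  qed
  then show ?thesis using assms by (metis subset_antisym)
qed

text \<open>
The blocks are the connected components of \<open>A\<close>. Since \<open>A\<close> branches in neither direction, a
component is a single increasing chain, so that its consecutive elements are exactly those
related by \<open>A\<close>.
\<close>

lemma partition_with_arcs:
  assumes A: "A \<subseteq> X \<times> X" and "0 \<notin> X"
    and sv: "single_valued A" "single_valued (A\<inverse>)"
    and inc: "\<And>i j. (i, j) \<in> A \<Longrightarrow> nesting_less i j"
  shows "\<exists>P. partition_on X P \<and> arcs P = A"
proof -
  define E where "E = (A \<union> A\<inverse>)\<^sup>* \<inter> X \<times> X"
  have "sym ((A \<union> A\<inverse>)\<^sup>*)" by (intro sym_rtrancl) (auto simp: sym_def)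
  then have "equiv X E"
    unfolding E_def by (intro equivI) (auto simp: refl_on_def sym_def trans_def)
  then have part: "partition_on X (X // E)" by (rule partition_on_quotient)
  have less: "nesting_less a b" if "(a, b) \<in> A\<^sup>+" for a b
    using that
  proof induction
    case (step y z)
    then have "z \<noteq> 0" using A \<open>0 \<notin> X\<close> by blast
    then show ?case using step inc nesting_less_trans by blast
  qed (use inc in blast)
  \<comment> \<open>Without branching, a walk that changes direction only retraces its steps.\<close>
  have linear: "(a, b) \<in> A\<^sup>* \<or> (b, a) \<in> A\<^sup>*" if "(a, b) \<in> (A \<union> A\<inverse>)\<^sup>*" for a b
    using that
  proof induction
    case (step y z)
    from step.hyps(2) show ?case
    proof
      assume yz: "(y, z) \<in> A"
      from step.IH show ?thesis
      proof
        assume "(y, a) \<in> A\<^sup>*"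
        then show ?thesis using yz single_valued_confluent[OF sv(1)] by blast
      qed (use yz in \<open>auto intro: rtrancl.rtrancl_into_rtrancl\<close>)
    next
      assume "(y, z) \<in> A\<inverse>"
      then have zy: "(z, y) \<in> A" by simp
      from step.IH show ?thesis
      proof
        assume "(a, y) \<in> A\<^sup>*"
        then have "(y, a) \<in> (A\<inverse>)\<^sup>*" by (simp add: rtrancl_converse)
        moreover have "(y, z) \<in> (A\<inverse>)\<^sup>*" using zy by blast
        ultimately show ?thesis using single_valued_confluent[OF sv(2)]
          by (metis converseD rtrancl_converse)
      qed (use zy in \<open>auto intro: converse_rtrancl_into_rtrancl\<close>)
    qed
  qed simp
  have chain: "(a, b) \<in> A\<^sup>+" if "(a, b) \<in> E" "nesting_less a b" for a b
  proof -
    have "a \<noteq> b" using that(2) nesting_less_asym by blast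
    moreover have "(b, a) \<notin> A\<^sup>+" using less that(2) nesting_less_asym by blast
    ultimately show ?thesis using linear that(1) unfolding E_def by (metis IntD1 rtranclD)
  qed
  have block: "(\<exists>B\<in>X // E. a \<in> B \<and> b \<in> B \<and> R B) \<longleftrightarrow> (a, b) \<in> E \<and> R (E `` {a})" for a b R
  proof
    assume "\<exists>B\<in>X // E. a \<in> B \<and> b \<in> B \<and> R B"
    then obtain B where B: "B \<in> X // E" "a \<in> B" "b \<in> B" "R B" by blast
    then have "B = E `` {a}" using \<open>equiv X E\<close>
      by (metis Image_singleton_iff equiv_class_eq quotientE)
    then show "(a, b) \<in> E \<and> R (E `` {a})" using B by blast
  next
    assume *: "(a, b) \<in> E \<and> R (E `` {a})"
    then have "a \<in> X" "(a, a) \<in> E" using \<open>equiv X E\<close> by (auto simp: E_def)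
    then show "\<exists>B\<in>X // E. a \<in> B \<and> b \<in> B \<and> R B" using * by (meson Image_singleton_iff quotientI)
  qed
  have "arcs (X // E) = A"
  proof (intro equalityI subrelI)
    fix i j assume "(i, j) \<in> arcs (X // E)"
    then have "\<exists>B\<in>X // E. i \<in> B \<and> j \<in> B \<and>
        (nesting_less i j \<and> \<not> (\<exists>m\<in>B. nesting_less i m \<and> nesting_less m j))"
      by (simp add: arcs_def)
    then have ij: "(i, j) \<in> E" "nesting_less i j"
      "\<not> (\<exists>m\<in>E `` {i}. nesting_less i m \<and> nesting_less m j)"
      unfolding block by blast+
    then obtain m where m: "(i, m) \<in> A" "(m, j) \<in> A\<^sup>*" using chain by (meson tranclD)
    then have "(i, m) \<in> E" using A unfolding E_def by auto
    then have "\<not> nesting_less m j" using ij(3) inc m(1) by blast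
    then have "m = j" using m(2) less by (metis rtranclD)
    then show "(i, j) \<in> A" using m by simp
  next
    fix i j assume ij: "(i, j) \<in> A"
    have "(i, j) \<in> E" using ij A unfolding E_def by auto
    moreover have "\<not> (nesting_less i m \<and> nesting_less m j)" if "(i, m) \<in> E" for m
    proof
      assume m: "nesting_less i m \<and> nesting_less m j"
      then obtain k where "(i, k) \<in> A" "(k, m) \<in> A\<^sup>*" using chain \<open>(i, m) \<in> E\<close> by (meson tranclD)
      then have "(j, m) \<in> A\<^sup>*" using ij sv(1) by (metis single_valuedD)
      then show False using m less nesting_less_asym by (metis rtranclD)
    qed
    ultimately have "\<exists>B\<in>X // E. i \<in> B \<and> j \<in> B \<and>
        (nesting_less i j \<and> \<not> (\<exists>m\<in>B. nesting_less i m \<and> nesting_less m j))"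
      unfolding block using inc[OF ij] by blast
    then show "(i, j) \<in> arcs (X // E)" by (simp add: arcs_def)
  qed
  then show ?thesis using part by blast
qed

lemma openers_conv_arcs:
  assumes "partition_on X P" "finite X" "0 \<notin> X"
  shows "openers P = {i. i > 0 \<and> i \<in> Domain (arcs P)}"
proof (intro equalityI subsetI)
  fix i assume "i \<in> openers P"
  then obtain B j where B: "i > 0" "B \<in> P" "i \<in> B" "j \<in> B" "nesting_less i j"
    by (auto simp: openers_def)
  then have "B \<subseteq> X" using assms(1) by (auto simp: partition_on_def)
  then have "finite B" "0 \<notin> B" using assms(2,3) by (auto intro: finite_subset)
  then have "(i, j) \<in> (arcs P)\<^sup>+" using arcs_trancl[OF B(2) _ _ B(3-5)] by simp
  then show "i \<in> {i. i > 0 \<and> i \<in> Domain (arcs P)}" using B(1) by (auto dest: tranclD)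
qed (auto simp: openers_def arcs_def)

lemma closers_conv_arcs:
  assumes "partition_on X P" "finite X" "0 \<notin> X"
  shows "closers P = {j. j > 0 \<and> j \<in> Range (arcs P)}"
proof (intro equalityI subsetI)
  fix i assume "i \<in> closers P"
  then obtain B j where B: "i > 0" "B \<in> P" "i \<in> B" "j \<in> B" "nesting_less j i"
    by (auto simp: closers_def)
  then have "B \<subseteq> X" using assms(1) by (auto simp: partition_on_def)
  then have "finite B" "0 \<notin> B" using assms(2,3) by (auto intro: finite_subset)
  then have "(j, i) \<in> (arcs P)\<^sup>+" using arcs_trancl[OF B(2) _ _ B(4,3,5)] by simp
  then show "i \<in> {i. i > 0 \<and> i \<in> Range (arcs P)}" using B(1) by (auto dest: tranclD2)
qed (auto simp: closers_def arcs_def)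

text \<open>
The effect of negating all blocks on arcs: negation reverses the nesting order, so the
endpoints of an arc are exchanged.
\<close>

definition mirror :: "(int \<times> int) set \<Rightarrow> (int \<times> int) set" where
  "mirror A = {(i, j). (- j, - i) \<in> A}"

lemma mem_mirror: "(i, j) \<in> mirror A \<longleftrightarrow> (- j, - i) \<in> A"
  by (simp add: mirror_def)

lemma uminus_image_iff: "(x::int) \<in> uminus ` B \<longleftrightarrow> - x \<in> B"
  by (metis image_iff minus_minus)

lemma negated_blocks_iff:
  fixes P :: "int set set"
  shows "(\<forall>B. B \<in> P \<longleftrightarrow> uminus ` B \<in> P) \<longleftrightarrow> (`) uminus ` P = P"
proof -
  have inv: "uminus ` uminus ` B = B" for B :: "int set" by (simp add: image_image)
  have mem: "B \<in> (`) uminus ` P \<longleftrightarrow> uminus ` B \<in> P" for B :: "int set"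
  proof
    assume "uminus ` B \<in> P"
    then show "B \<in> (`) uminus ` P" using inv[of B] by (intro image_eqI[of _ _ "uminus ` B"]) auto
  qed (auto simp: inv)
  show ?thesis unfolding set_eq_iff mem by blast
qed

lemma arcs_negated_blocks:
  assumes "0 \<notin> \<Union>P"
  shows "arcs ((`) uminus ` P) = mirror (arcs P)"
proof -
  have nz: "x \<noteq> 0" if "B \<in> P" "x \<in> B" for B x using that assms by auto
  have "(i, j) \<in> arcs ((`) uminus ` P) \<longleftrightarrow> (- j, - i) \<in> arcs P" for i j
  proof -
    have "(i, j) \<in> arcs ((`) uminus ` P) \<longleftrightarrow>
       (\<exists>B\<in>P. - i \<in> B \<and> - j \<in> B \<and> nesting_less i j \<and>
          \<not> (\<exists>m\<in>B. nesting_less i (- m) \<and> nesting_less (- m) j))"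
      by (simp add: arcs_def uminus_image_iff)
    also have "\<dots> \<longleftrightarrow> (\<exists>B\<in>P. - i \<in> B \<and> - j \<in> B \<and> nesting_less (- j) (- i) \<and>
          \<not> (\<exists>m\<in>B. nesting_less m (- i) \<and> nesting_less (- j) m))"
    proof (rule bex_cong[OF refl])
      fix B assume "B \<in> P"
      then show "(- i \<in> B \<and> - j \<in> B \<and> nesting_less i j \<and>
          \<not> (\<exists>m\<in>B. nesting_less i (- m) \<and> nesting_less (- m) j)) \<longleftrightarrow>
        (- i \<in> B \<and> - j \<in> B \<and> nesting_less (- j) (- i) \<and>
          \<not> (\<exists>m\<in>B. nesting_less m (- i) \<and> nesting_less (- j) m))"
        using nz nesting_less_uminus[of "- i" _] nesting_less_uminus[of _ "- j"]
          nesting_less_uminus[of i j]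
        by (smt (verit) minus_minus)
    qed
    also have "\<dots> \<longleftrightarrow> (- j, - i) \<in> arcs P" by (auto simp: arcs_def)
    finally show ?thesis .
  qed
  then show ?thesis by (auto simp: mem_mirror)
qed

lemma partition_negated_blocks:
  assumes "partition_on (pm_set n) P"
  shows "partition_on (pm_set n) ((`) uminus ` P)"
proof -
  have "partition_on (uminus ` pm_set n) ((`) uminus ` P - {{}})"
    using assms by (intro partition_on_inj_image) auto
  moreover have "uminus ` pm_set n = pm_set n"
    by (auto simp: set_eq_iff uminus_image_iff pm_set_iff)
  moreover have "{} \<notin> (`) uminus ` P" using assms by (auto simp: partition_on_def)
  ultimately show ?thesis by simp
qed

text \<open>
Arcs determine a partition, hence invariance under negation can be tested on the arcs.
\<close>

lemma negated_blocks_iff_mirror_arcs: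
  assumes "partition_on (pm_set n) P"
  shows "(\<forall>B. B \<in> P \<longleftrightarrow> uminus ` B \<in> P) \<longleftrightarrow> mirror (arcs P) = arcs P"
proof -
  have 0: "0 \<notin> pm_set n" by (simp add: pm_set_iff)
  have "0 \<notin> \<Union>P" using assms 0 by (auto simp: partition_on_def)
  then show ?thesis unfolding negated_blocks_iff
    using partition_eq_if_arcs_eq[OF partition_negated_blocks[OF assms] assms finite_pm_set 0]
    by (metis arcs_negated_blocks)
qed

text \<open>
In a block that is its own negative, the largest positive element \<open>i\<close> is directly followed by
\<open>- i\<close>.
\<close>

lemma zero_block_arc:
  assumes "B \<in> P" "B = uminus ` B" "finite B" "0 \<notin> B" "B \<noteq> {}"
  shows "\<exists>i>0. i \<in> B \<and> (i, - i) \<in> arcs P"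
proof -
  have neg: "x \<in> B \<longleftrightarrow> - x \<in> B" for x using assms(2) uminus_image_iff by metis
  define i where "i = Max {x \<in> B. x > 0}"
  obtain x where "x \<in> B" using assms(5) by blast
  then have "x \<in> {x \<in> B. x > 0} \<or> - x \<in> {x \<in> B. x > 0}" using neg assms(4)
    by (metis linorder_neqE_linordered_idom mem_Collect_eq neg_0_less_iff_less)
  then have "{x \<in> B. x > 0} \<noteq> {}" by blast
  then have i: "i \<in> B" "i > 0" unfolding i_def using Max_in[of "{x \<in> B. x > 0}"] assms(3) by auto
  have le: "m \<le> i" if "m \<in> B" "m > 0" for m unfolding i_def using that assms(3) by (auto intro: Max_ge)
  have "\<not> (nesting_less i m \<and> nesting_less m (- i))" if "m \<in> B" for m
    using le[OF that] le[of "- m"] that neg i(2) by (auto simp: nesting_less_def)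
  moreover have "nesting_less i (- i)" using i by (simp add: nesting_less_def)
  ultimately show ?thesis using i neg assms(1) by (auto simp: arcs_def)
qed

section \<open>Last-in-first-out matchings\<close>

text \<open>
Since the openers in \<open>Op\<close> may have no partner in \<open>M\<close>, this expresses two things at once: arcs
of \<open>M\<close> do not cross, and no unmatched opener lies under an arc.
\<close>

definition well_nested :: "int set \<Rightarrow> (int \<times> int) set \<Rightarrow> bool" where
  "well_nested Op M \<longleftrightarrow> (\<forall>a b c. (a, b) \<in> M \<and> c \<in> Op \<and> a < c \<and> c < b \<longrightarrow> (\<exists>d<b. (c, d) \<in> M))"

lemma well_nestedI:
  "(\<And>a b c. (a, b) \<in> M \<Longrightarrow> c \<in> Op \<Longrightarrow> a < c \<Longrightarrow> c < b \<Longrightarrow> \<exists>d<b. (c, d) \<in> M) \<Longrightarrow> well_nested Op M"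
  unfolding well_nested_def by blast

lemma well_nestedD:
  assumes "well_nested Op M" "(a, b) \<in> M" "c \<in> Op" "a < c" "c < b"
  obtains d where "d < b" "(c, d) \<in> M"
  using assms unfolding well_nested_def by meson

text \<open>
Every closer finds an opener on its left, in the manner of a stack, while openers may remain
unmatched.
\<close>

definition stack_matching :: "int set \<Rightarrow> int set \<Rightarrow> (int \<times> int) set \<Rightarrow> bool" where
  "stack_matching Op Cl M \<longleftrightarrow>
     M \<subseteq> {(i, j). i < j} \<and> Domain M \<subseteq> Op \<and> Range M = Cl \<and>
     single_valued M \<and> single_valued (M\<inverse>) \<and>
     well_nested Op M"

lemma stack_matching_nested:
  assumes "stack_matching Op Cl M" "(a, b) \<in> M" "c \<in> Op" "a < c" "c < b"
  shows "\<exists>d<b. (c, d) \<in> M"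
proof -
  have "well_nested Op M" using assms(1) by (simp add: stack_matching_def)
  then show ?thesis using assms(2-5) unfolding well_nested_def by meson
qed

lemma card_Domain_single_valued:
  "single_valued R \<Longrightarrow> card (Domain R) = card R"
  unfolding Domain_fst by (rule card_image) (auto simp: inj_on_def single_valued_def)

lemma card_Range_single_valued:
  "single_valued (R\<inverse>) \<Longrightarrow> card (Range R) = card R"
  unfolding Range_snd by (rule card_image) (auto simp: inj_on_def single_valued_def)

text \<open>
Truncation preserves nestedness because an opener under an arc has its partner under the same
arc; this makes the induction below possible.
\<close>

lemma stack_matching_restrict:
  assumes M: "stack_matching Op Cl M" and pos: "Op \<subseteq> {1..}" "Cl \<subseteq> {1..}"
  shows "stack_matching (Op \<inter> {1..N}) (Cl \<inter> {1..N}) {(i, j) \<in> M. j \<le> N}"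
    (is "stack_matching _ _ ?M")
  unfolding stack_matching_def
proof (intro conjI)
  have lt: "i < j \<and> i \<in> Op" if "(i, j) \<in> M" for i j
    using M that by (auto simp: stack_matching_def)
  show "?M \<subseteq> {(i, j). i < j}" using lt by blast
  show "Domain ?M \<subseteq> Op \<inter> {1..N}" using lt pos(1) by fastforce
  show "Range ?M = Cl \<inter> {1..N}" using M pos(2) by (auto simp: stack_matching_def)
  show "single_valued ?M" "single_valued (?M\<inverse>)"
    using M by (auto simp: stack_matching_def single_valued_def)
  show "well_nested (Op \<inter> {1..N}) ?M"
  proof (rule well_nestedI)
    fix a b c assume *: "(a, b) \<in> ?M" "c \<in> Op \<inter> {1..N}" "a < c" "c < b"
    then have "\<exists>d<b. (c, d) \<in> M" by (intro stack_matching_nested[OF M]) auto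
    then obtain d where "d < b" "(c, d) \<in> M" by blast
    then show "\<exists>d<b. (c, d) \<in> ?M" using * by auto
  qed
qed

lemma opener_closer_configD:
  assumes "opener_closer_config N Op Cl"
  shows "Op \<subseteq> {1..int N}" and "Cl \<subseteq> {1..int N}"
    and "k < N \<Longrightarrow> card (Cl \<inter> {1..int (k + 1)}) \<le> card (Op \<inter> {1..int k})"
  using assms unfolding opener_closer_config_def by blast+

text \<open>
If \<open>N + 1\<close> is a closer, its partner must be the largest opener \<open>u\<close> that is still unmatched: an
arc starting further left would cover \<open>u\<close>, whose partner would have to lie under that arc too.
The hypothesis on the configuration ensures that some opener is still unmatched.
\<close>

lemma stack_matching_ex1:
  assumes "opener_closer_config N Op Cl"
  shows "\<exists>!M. stack_matching Op Cl M"
  using assms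
proof (induction N arbitrary: Op Cl)
  case 0
  have "Op = {}" "Cl = {}"
    using opener_closer_configD(1,2)[OF 0] by simp_all
  show ?case
    unfolding \<open>Op = {}\<close> \<open>Cl = {}\<close>
  proof (rule ex1I[of _ "{}"])
    show "stack_matching {} {} {}" 
      unfolding stack_matching_def by (intro conjI well_nestedI) simp_all
    show "M = {}" if "stack_matching {} {} M" for M
    proof -
      have "Range M = {}" using that by (simp add: stack_matching_def)
      then show ?thesis by (simp add: Range_empty_iff)
    qed
  qed
next
  case (Suc N)
  define s where "s = int N + 1"
  define Op' where "Op' = Op \<inter> {1..int N}"
  define Cl' where "Cl' = Cl \<inter> {1..int N}"
  have sub: "Op \<subseteq> {1..s}" "Cl \<subseteq> {1..s}"
    using opener_closer_configD(1,2)[OF Suc.prems] by (simp_all add: s_def add.commute)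
  have pos: "Op \<subseteq> {1..}" "Cl \<subseteq> {1..}" using sub by auto
  note ballot = opener_closer_configD(3)[OF Suc.prems]
  have "card (Cl' \<inter> {1..int (k + 1)}) \<le> card (Op' \<inter> {1..int k})" if "k < N" for k
  proof -
    have "Cl' \<inter> {1..int (k + 1)} = Cl \<inter> {1..int (k + 1)}" "Op' \<inter> {1..int k} = Op \<inter> {1..int k}"
      using that by (auto simp: Cl'_def Op'_def)
    then show ?thesis using ballot[of k] that by simp
  qed
  then have "opener_closer_config N Op' Cl'"
    unfolding opener_closer_config_def by (simp add: Op'_def Cl'_def)
  then obtain M' where M': "stack_matching Op' Cl' M'"
    and uniq: "\<And>M. stack_matching Op' Cl' M \<Longrightarrow> M = M'" using Suc.IH by metis
  have restrict: "{(i, j) \<in> M. j \<le> int N} = M'" if "stack_matching Op Cl M" for M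
    using uniq[OF stack_matching_restrict[OF that pos, of "int N", folded Op'_def Cl'_def]] .
  have M'_bounds: "i < j \<and> j \<le> int N" if "(i, j) \<in> M'" for i j
  proof -
    have "j \<in> Cl'" using that M' by (auto simp: stack_matching_def)
    then show ?thesis using M' that by (auto simp: stack_matching_def Cl'_def)
  qed
  show ?case
  proof (cases "s \<in> Cl")
    case False
    have "x \<le> int N" if "x \<in> Cl" for x
      using subsetD[OF sub(2) that] that False by (cases "x = s") (auto simp: s_def)
    then have Cl: "Cl' = Cl" using pos by (auto simp: Cl'_def)
    have "stack_matching Op Cl M'"
      unfolding stack_matching_def
    proof (intro conjI)
      show "M' \<subseteq> {(i, j). i < j}" using M'_bounds by auto
      show "Domain M' \<subseteq> Op" "Range M' = Cl" "single_valued M'" "single_valued (M'\<inverse>)"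
        using M' Cl by (auto simp: stack_matching_def Op'_def)
      show "well_nested Op M'"
      proof (rule well_nestedI)
        fix a b c assume *: "(a, b) \<in> M'" "c \<in> Op" "a < c" "c < b"
        then have "c \<in> Op'" using M'_bounds[of a b] subsetD[OF pos(1)] by (auto simp: Op'_def)
        then show "\<exists>d<b. (c, d) \<in> M'" by (rule stack_matching_nested[OF M' *(1) _ *(3,4)])
      qed
    qed
    moreover have "M = M'" if "stack_matching Op Cl M" for M
    proof -
      have "j \<le> int N" if "(i, j) \<in> M" for i j
      proof -
        have "j \<in> Cl'" using that \<open>stack_matching Op Cl M\<close> Cl by (auto simp: stack_matching_def)
        then show ?thesis by (simp add: Cl'_def)
      qed
      then have "{(i, j) \<in> M. j \<le> int N} = M" by blast
      then show ?thesis using restrict[OF that] by simp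
    qed
    ultimately show ?thesis by (rule ex1I)
  next
    case True
    define U where "U = Op' - Domain M'"
    have fin: "finite U" "finite Op'" "finite Cl'" by (simp_all add: U_def Op'_def Cl'_def)
    have "insert s ({1..int N}) = {1..int (N + 1)}" by (auto simp: s_def)
    then have "Cl \<inter> {1..int (N + 1)} = insert s Cl'"
      using True by (auto simp: Cl'_def)
    then have "card Cl' + 1 \<le> card Op'"
      using ballot[of N] fin by (simp add: Op'_def Cl'_def s_def)
    moreover have "card (Domain M') = card Cl'"
      using M' card_Domain_single_valued[of M'] card_Range_single_valued[of M'] 
      by (auto simp: stack_matching_def)
    ultimately have "card (Domain M') < card Op'" by simp
    moreover have "Domain M' \<subseteq> Op'" using M' by (simp add: stack_matching_def)
    ultimately have "U \<noteq> {}" unfolding U_def by auto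
    define u where "u = Max U"
    have u: "u \<in> U" unfolding u_def using fin \<open>U \<noteq> {}\<close> by simp
    have u_ge: "v \<le> u" if "v \<in> U" for v unfolding u_def using fin that by simp
    have us: "u < s" using u by (auto simp: U_def Op'_def s_def)
    define M where "M = insert (u, s) M'"
    have "stack_matching Op Cl M"
      unfolding stack_matching_def
    proof (intro conjI)
      show "M \<subseteq> {(i, j). i < j}" using M'_bounds us by (auto simp: M_def)
      show "Domain M \<subseteq> Op" using M' u by (auto simp: M_def stack_matching_def U_def Op'_def)
      show "Range M = Cl"
      proof -
        have "Range M = insert s Cl'" using M' by (auto simp: M_def stack_matching_def)
        moreover have "insert s {1..int N} = {1..s}" by (auto simp: s_def)
        ultimately show ?thesis using True sub(2) by (auto simp: Cl'_def)
      qed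
      show "single_valued M" using M' u
        by (auto simp: M_def stack_matching_def single_valued_def U_def Domain_iff)
      have "(i, s) \<notin> M'" for i using M'_bounds[of i s] by (auto simp: s_def)
      then show "single_valued (M\<inverse>)" using M'
        by (auto simp: M_def stack_matching_def single_valued_def)
      show "well_nested Op M"
      proof (rule well_nestedI)
        fix a b c assume *: "(a, b) \<in> M" "c \<in> Op" "a < c" "c < b"
        show "\<exists>d<b. (c, d) \<in> M"
        proof (cases "(a, b) = (u, s)")
          case True
          have "c \<in> Op'" using * True subsetD[OF pos(1)] by (auto simp: Op'_def s_def)
          moreover have "c \<notin> U" using u_ge[of c] * True by auto
          ultimately obtain d where "(c, d) \<in> M'" unfolding U_def by blast
          then show ?thesis using M'_bounds[of c d] True by (auto simp: M_def s_def)
        next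
          case False
          then have ab: "(a, b) \<in> M'" using *(1) unfolding M_def by blast
          then have "c \<in> Op'" using * M'_bounds[of a b] subsetD[OF pos(1)] by (auto simp: Op'_def)
          then have "\<exists>d<b. (c, d) \<in> M'" by (rule stack_matching_nested[OF M' ab _ *(3,4)])
          then show ?thesis unfolding M_def by blast
        qed
      qed
    qed
    moreover have "L = M" if L: "stack_matching Op Cl L" for L
    proof -
      have lt: "i < j" if "(i, j) \<in> L" for i j using L that by (auto simp: stack_matching_def)
      have le: "j \<le> s" if "(i, j) \<in> L" for i j
      proof -
        have "j \<in> Cl" using L that by (auto simp: stack_matching_def)
        then show ?thesis using sub(2) by auto
      qed
      have split: "(i, j) \<in> M' \<longleftrightarrow> (i, j) \<in> L \<and> j \<noteq> s" for i j
        using restrict[OF L, symmetric] le[of i j] by (auto simp: s_def)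
      obtain v where v: "(v, s) \<in> L" using L True by (auto simp: stack_matching_def)
      have "v \<in> Op" using L v by (auto simp: stack_matching_def)
      then have "v \<in> Op'" using lt[OF v] subsetD[OF pos(1)] by (auto simp: Op'_def s_def)
      moreover have "v \<notin> Domain M'"
        using v L unfolding stack_matching_def single_valued_def by (auto simp: split)
      ultimately have "v \<in> U" by (simp add: U_def)
      moreover have "\<not> v < u"
      proof
        assume vu: "v < u"
        have "u \<in> Op" using u by (simp add: U_def Op'_def)
        then have "\<exists>d<s. (u, d) \<in> L" by (rule stack_matching_nested[OF L v _ vu us])
        then obtain d where "d < s" "(u, d) \<in> L" by blast
        then have "(u, d) \<in> M'" by (simp add: split)
        then show False using u by (auto simp: U_def)
      qed
      ultimately have "v = u" using u_ge[of v] by simp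
      have vs: "i = v" if "(i, s) \<in> L" for i
        using v that L unfolding stack_matching_def by (meson converseI single_valuedD)
      have "(i, j) \<in> L \<longleftrightarrow> (i, j) \<in> insert (v, s) M'" for i j
        using v vs[of i] split[of i j] by (cases "j = s") auto
      then have "L = insert (v, s) M'" by auto
      then show ?thesis using \<open>v = u\<close> by (simp add: M_def)
    qed
    ultimately show ?thesis by (rule ex1I)
  qed
qed

section \<open>Order-reversing relations and medians\<close>

definition below :: "int set \<Rightarrow> int \<Rightarrow> nat" where
  "below K x = card {u \<in> K. u < x}"

definition above :: "int set \<Rightarrow> int \<Rightarrow> nat" where
  "above K x = card {u \<in> K. x < u}"

text \<open>
The smallest element of \<open>K\<close> is related to the largest one, the second smallest to the second
largest, and so on.
\<close>

definition reversal :: "int set \<Rightarrow> (int \<times> int) set" where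
  "reversal K = {(i, j). i \<in> K \<and> j \<in> K \<and> below K i = above K j}"

text \<open>
The inequality says that \<open>i\<close> belongs to the upper half of \<open>K\<close>, in the form in which the condition
\<open>l > k/2\<close> on central arcs is stated. Thus \<open>x\<close> lies between the two halves of \<open>K\<close>.
\<close>

definition separates :: "int set \<Rightarrow> int \<Rightarrow> bool" where
  "separates K x \<longleftrightarrow> (\<forall>i\<in>K. x < i \<longleftrightarrow> card K < 2 * card {u \<in> K. u \<le> i})"

lemma below_above_notin:
  assumes "finite K" "x \<notin> K"
  shows "card K = below K x + above K x"
proof -
  have "K = {u \<in> K. u < x} \<union> {u \<in> K. x < u}"
    using assms linorder_neq_iff[of _ x] by blast
  then have "card K = card ({u \<in> K. u < x} \<union> {u \<in> K. x < u})" by simp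
  also have "\<dots> = below K x + above K x"
    unfolding below_def above_def using assms by (intro card_Un_disjoint) auto
  finally show ?thesis .
qed

lemma below_above_in:
  assumes "finite K" "x \<in> K"
  shows "card K = Suc (below K x + above K x)"
proof -
  have "below (K - {x}) x = below K x" "above (K - {x}) x = above K x"
    unfolding below_def above_def by (auto intro!: arg_cong[where f = card])
  moreover have "card K = Suc (card (K - {x}))" using assms by (metis card_Suc_Diff1)
  ultimately show ?thesis using below_above_notin[of "K - {x}" x] assms by simp
qed

lemma card_le_eq_Suc_below:
  assumes "finite K" "x \<in> K"
  shows "card {u \<in> K. u \<le> x} = Suc (below K x)"
proof -
  have "{u \<in> K. u \<le> x} = insert x {u \<in> K. u < x}" using assms by auto
  then show ?thesis using assms by (simp add: below_def)
qed

lemma below_strict_mono: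
  "finite K \<Longrightarrow> x \<in> K \<Longrightarrow> x < y \<Longrightarrow> below K x < below K y"
  unfolding below_def by (intro psubset_card_mono) auto

lemma below_inj:
  "finite K \<Longrightarrow> x \<in> K \<Longrightarrow> y \<in> K \<Longrightarrow> below K x = below K y \<longleftrightarrow> x = y"
  using below_strict_mono[of K x y] below_strict_mono[of K y x] by (cases x y rule: linorder_cases) auto

lemma above_inj:
  assumes "finite K" "x \<in> K" "y \<in> K"
  shows "above K x = above K y \<longleftrightarrow> x = y"
  using below_above_in[OF assms(1,2)] below_above_in[OF assms(1,3)] below_inj[OF assms] by auto

lemma below_surj:
  assumes "finite K" "r < card K"
  shows "\<exists>x\<in>K. below K x = r"
proof -
  have "inj_on (below K) K" using below_inj assms(1) by (auto simp: inj_on_def)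
  moreover have "below K x < card K" if "x \<in> K" for x
    using below_above_in[OF assms(1) that] by simp
  then have "below K ` K \<subseteq> {..<card K}" by auto
  ultimately have "below K ` K = {..<card K}"
    by (intro card_subset_eq) (auto simp: card_image)
  then show ?thesis using assms(2) by (metis imageE lessThan_iff)
qed

lemma sym_reversal: "finite K \<Longrightarrow> sym (reversal K)"
proof (rule symI)
  fix i j assume "finite K" "(i, j) \<in> reversal K"
  then show "(j, i) \<in> reversal K"
    using below_above_in[of K i] below_above_in[of K j] by (auto simp: reversal_def)
qed

lemma single_valued_reversal: "finite K \<Longrightarrow> single_valued (reversal K)"
  by (auto simp: single_valued_def reversal_def above_inj[symmetric])

lemma Domain_reversal:
  assumes "finite K"
  shows "Domain (reversal K) = K"
proof (intro equalityI subsetI)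
  fix i assume i: "i \<in> K"
  then have "above K i < card K" using below_above_in[OF assms i] by simp
  then obtain j where "j \<in> K" "below K j = above K i" using below_surj assms by blast
  then have "(j, i) \<in> reversal K" using i by (simp add: reversal_def)
  then show "i \<in> Domain (reversal K)" using sym_reversal[OF assms] by (meson DomainI symD)
qed (auto simp: reversal_def)

lemma reversal_decreasing:
  assumes "finite K" "(i, j) \<in> reversal K" "(i', j') \<in> reversal K"
  shows "\<not> (i < i' \<and> j < j')"
proof
  assume less: "i < i' \<and> j < j'"
  have K: "i \<in> K" "j \<in> K" "j' \<in> K" "below K i = above K j" "below K i' = above K j'"
    using assms by (auto simp: reversal_def)
  then have "below K i < below K i'" "below K j < below K j'"
    using below_strict_mono[OF assms(1)] less by blast+
  then show False
    using below_above_in[OF assms(1) K(2)] below_above_in[OF assms(1) K(3)] K(4,5) by linarith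
qed

text \<open>
A fixed point has as many elements below as above, so it is the median of a set of odd size.
\<close>

lemma reversal_fixed_point_iff:
  assumes "finite K"
  shows "(\<exists>i. (i, i) \<in> reversal K) \<longleftrightarrow> odd (card K)"
proof
  assume "odd (card K)"
  then have "card K div 2 < card K" by (cases "card K") auto
  then obtain i where i: "i \<in> K" "below K i = card K div 2" using below_surj assms by blast
  then have "(i, i) \<in> reversal K"
    using below_above_in[OF assms i(1)] \<open>odd (card K)\<close> by (auto simp: reversal_def elim!: oddE)
  then show "\<exists>i. (i, i) \<in> reversal K" by blast
qed (use below_above_in[OF assms] in \<open>auto simp: reversal_def\<close>)

text \<open>
A symmetric single-valued relation is the graph of an involution. As this involution reverses the
order, it maps the elements below \<open>i\<close> bijectively to the elements above the partner of \<open>i\<close>.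
\<close>

lemma reversal_unique:
  assumes "finite (Domain G)" "sym G" "single_valued G"
    and dec: "\<And>i j i' j'. (i, j) \<in> G \<Longrightarrow> (i', j') \<in> G \<Longrightarrow> \<not> (i < i' \<and> j < j')"
  shows "G = reversal (Domain G)"
proof -
  define K where "K = Domain G"
  have symG: "(j, i) \<in> G" if "(i, j) \<in> G" for i j using assms(2) that by (rule symD)
  have sv: "j = j'" if "(i, j) \<in> G" "(i, j') \<in> G" for i j j'
    using assms(3) that by (rule single_valuedD)
  have "\<forall>i\<in>K. \<exists>j. (i, j) \<in> G" by (auto simp: K_def)
  then obtain f where f: "\<And>i. i \<in> K \<Longrightarrow> (i, f i) \<in> G" by metis
  have fK: "f i \<in> K" "f (f i) = i" if "i \<in> K" for i
  proof -
    have "(f i, i) \<in> G" using f[OF that] symG by blast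
    then show "f i \<in> K" by (auto simp: K_def)
    then show "f (f i) = i" using f sv \<open>(f i, i) \<in> G\<close> by blast
  qed
  have swap: "f v < f u" if "u \<in> K" "v \<in> K" "u < v" for u v
  proof -
    have "f u \<noteq> f v" using fK that by (metis less_irrefl)
    then show ?thesis using dec[OF f[OF that(1)] f[OF that(2)]] that(3) by force
  qed
  have sub: "(i, j) \<in> reversal K" if "(i, j) \<in> G" for i j
  proof -
    have ij: "i \<in> K" "j \<in> K" "f i = j" "f j = i"
      using that symG[OF that] f sv by (auto simp: K_def)
    have "bij_betw f {u \<in> K. u < i} {u \<in> K. j < u}"
      by (rule bij_betwI[where g = f]) (use swap[of _ i] swap[of j] ij fK in auto)
    then have "below K i = above K j"
      unfolding below_def above_def by (rule bij_betw_same_card)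
    then show ?thesis using ij by (simp add: reversal_def)
  qed
  moreover have "(i, j) \<in> G" if "(i, j) \<in> reversal K" for i j
  proof -
    have "i \<in> K" using that by (simp add: reversal_def)
    then show ?thesis
      using f[of i] sub[OF f[of i]] that single_valued_reversal[of K] assms(1)
      by (metis K_def single_valuedD)
  qed
  ultimately show ?thesis unfolding K_def by auto
qed

text \<open>
The mirror image of a central arc \<open>(i, - j)\<close> is \<open>(j, - i)\<close>, so mirroring exchanges upper and
lower central arcs.
\<close>

lemma reversal_swaps_halves:
  assumes "finite K" "even (card K)" "(i, j) \<in> reversal K"
  shows "card K < 2 * card {u \<in> K. u \<le> j} \<longleftrightarrow> \<not> card K < 2 * card {u \<in> K. u \<le> i}"
proof -
  have ij: "i \<in> K" "j \<in> K" "below K i = above K j" using assms(3) by (auto simp: reversal_def)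
  then show ?thesis
    using below_above_in[OF assms(1) ij(2)] assms(2)
    by (auto simp: card_le_eq_Suc_below[OF assms(1)] elim!: evenE) presburger+
qed

text \<open>
The two halves have the same size. If \<open>x\<close> has more elements below than above, the largest element
below \<open>x\<close> is already in the upper half, and dually.
\<close>

lemma separates_iff:
  assumes "finite K" "even (card K)" "x \<notin> K"
  shows "separates K x \<longleftrightarrow> below K x = above K x"
proof
  have tot: "card K = below K x + above K x" using assms by (intro below_above_notin)
  {
    assume sep: "separates K x"
    show "below K x = above K x"
    proof (rule ccontr)
      assume "below K x \<noteq> above K x"
      then consider "above K x < below K x" | "below K x < above K x" by linarith
      then show False
      proof cases
        case 1
        define i where "i = Max {u \<in> K. u < x}"
        have ne: "{u \<in> K. u < x} \<noteq> {}" using 1 unfolding below_def by (metis card.empty not_less_zero)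
        then have i: "i \<in> K" "i < x" unfolding i_def using Max_in[OF _ ne] assms by auto
        have "u \<le> i" if "u \<in> K" "u < x" for u unfolding i_def using assms that by simp
        then have "{u \<in> K. u \<le> i} = {u \<in> K. u < x}" using i by force
        then show False using sep i 1 tot by (auto simp: separates_def below_def)
      next
        case 2
        define i where "i = Min {u \<in> K. x < u}"
        have ne: "{u \<in> K. x < u} \<noteq> {}" using 2 unfolding above_def by (metis card.empty not_less_zero)
        then have i: "i \<in> K" "x < i" unfolding i_def using Min_in[OF _ ne] assms by auto
        have "i \<le> u" if "u \<in> K" "x < u" for u unfolding i_def using assms that by simp
        then have "{u \<in> K. u < i} = {u \<in> K. u < x}"
          using i assms(3) by (metis (no_types, lifting) leD less_trans linorder_cases)
        then have "card {u \<in> K. u \<le> i} = Suc (below K x)"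
          using card_le_eq_Suc_below assms i by (simp add: below_def)
        then have "card K < 2 * Suc (below K x)" using sep i unfolding separates_def by metis
        then show False using 2 tot assms(2) by presburger
      qed
    qed
  }
  assume eq: "below K x = above K x"
  show "separates K x"
    unfolding separates_def
  proof
    fix i assume i: "i \<in> K"
    show "x < i \<longleftrightarrow> card K < 2 * card {u \<in> K. u \<le> i}"
    proof (cases "x < i")
      case True
      then have "{u \<in> K. u < x} \<subseteq> {u \<in> K. u < i}" by auto
      then have "below K x \<le> below K i" using assms by (auto simp: below_def intro: card_mono)
      then show ?thesis using True eq tot card_le_eq_Suc_below assms i by simp
    next
      case False
      then have "i < x" using assms(3) i by (metis linorder_neqE)
      then have "{u \<in> K. u \<le> i} \<subseteq> {u \<in> K. u < x}" by auto
      then have "card {u \<in> K. u \<le> i} \<le> below K x" using assms by (auto simp: below_def intro: card_mono)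
      then show ?thesis using False eq tot by simp
    qed
  qed
qed

section \<open>Symmetric partitions as pairs of relations on the positive elements\<close>

text \<open>
The arcs encoded by \<open>F\<close> and \<open>G\<close>: those between positive elements, their mirror images, and those
from a positive to a negative element.
\<close>

definition sym_arcs :: "(int \<times> int) set \<Rightarrow> (int \<times> int) set \<Rightarrow> (int \<times> int) set" where
  "sym_arcs F G = F \<union> mirror F \<union> {(i, j). (i, - j) \<in> G}"

text \<open>
These conditions characterize the pairs that arise from partitions of \<open>pm_set n\<close> closed under
negation, see \<open>partition_of_half_arcs\<close> and \<open>half_arcs_of_partition\<close>.
\<close>

definition half_arcs :: "nat \<Rightarrow> (int \<times> int) set \<Rightarrow> (int \<times> int) set \<Rightarrow> bool" where
  "half_arcs n F G \<longleftrightarrow>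
     F \<subseteq> {(i, j). 0 < i \<and> i < j \<and> j \<le> int n} \<and> G \<subseteq> {1..int n} \<times> {1..int n} \<and> sym G \<and>
     single_valued F \<and> single_valued (F\<inverse>) \<and> single_valued G \<and> Domain F \<inter> Domain G = {}"

lemma mem_sym_arcs:
  "(i, j) \<in> sym_arcs F G \<longleftrightarrow> (i, j) \<in> F \<or> (- j, - i) \<in> F \<or> (i, - j) \<in> G"
  by (simp add: sym_arcs_def mem_mirror)

lemma half_arcsD:
  assumes "half_arcs n F G"
  shows "(a, b) \<in> F \<Longrightarrow> 0 < a \<and> a < b \<and> b \<le> int n"
    and "(i, j) \<in> G \<Longrightarrow> 0 < i \<and> i \<le> int n \<and> 0 < j \<and> j \<le> int n"
    and "(i, j) \<in> G \<Longrightarrow> (j, i) \<in> G"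
    and "(a, b) \<in> F \<Longrightarrow> (a, c) \<in> F \<Longrightarrow> b = c"
    and "(a, c) \<in> F \<Longrightarrow> (b, c) \<in> F \<Longrightarrow> a = b"
    and "(a, b) \<in> G \<Longrightarrow> (a, c) \<in> G \<Longrightarrow> b = c"
    and "(a, c) \<in> G \<Longrightarrow> (b, c) \<in> G \<Longrightarrow> a = b"
    and "(a, b) \<in> F \<Longrightarrow> (a, c) \<notin> G"
proof -
  have F: "F \<subseteq> {(i, j). 0 < i \<and> i < j \<and> j \<le> int n}" "single_valued F" "single_valued (F\<inverse>)"
    and G: "G \<subseteq> {1..int n} \<times> {1..int n}" "sym G" "single_valued G"
    and disj: "Domain F \<inter> Domain G = {}"
    using assms by (simp_all add: half_arcs_def)
  show "(a, b) \<in> F \<Longrightarrow> 0 < a \<and> a < b \<and> b \<le> int n" using F(1) by blast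
  show "(i, j) \<in> G \<Longrightarrow> 0 < i \<and> i \<le> int n \<and> 0 < j \<and> j \<le> int n" using G(1) by auto
  show symG: "(i, j) \<in> G \<Longrightarrow> (j, i) \<in> G" for i j using G(2) by (rule symD)
  show "(a, b) \<in> F \<Longrightarrow> (a, c) \<in> F \<Longrightarrow> b = c" using F(2) by (rule single_valuedD)
  show "(a, c) \<in> F \<Longrightarrow> (b, c) \<in> F \<Longrightarrow> a = b"
    using F(3) by (meson converseI single_valuedD)
  show "(a, b) \<in> G \<Longrightarrow> (a, c) \<in> G \<Longrightarrow> b = c" using G(3) by (rule single_valuedD)
  show "(a, c) \<in> G \<Longrightarrow> (b, c) \<in> G \<Longrightarrow> a = b" using G(3) symG by (meson single_valuedD)
  show "(a, b) \<in> F \<Longrightarrow> (a, c) \<notin> G" using disj by blast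
qed

lemma sym_arcs_pos:
  assumes "half_arcs n F G" "0 < i" "0 < j"
  shows "(i, j) \<in> sym_arcs F G \<longleftrightarrow> (i, j) \<in> F" and "(i, - j) \<in> sym_arcs F G \<longleftrightarrow> (i, j) \<in> G"
  using half_arcsD(1)[OF assms(1), of "- j" "- i"] half_arcsD(2)[OF assms(1), of i "- j"]
    half_arcsD(1)[OF assms(1), of i "- j"] half_arcsD(1)[OF assms(1), of j "- i"] assms(2,3)
  by (auto simp: mem_sym_arcs)

lemma sym_arcs_inject:
  assumes "half_arcs n F G" "half_arcs n F' G'" "sym_arcs F G = sym_arcs F' G'"
  shows "F = F' \<and> G = G'"
proof -
  have "(i, j) \<in> F \<longleftrightarrow> (i, j) \<in> F'" for i j
  proof (cases "0 < i \<and> 0 < j")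
    case False
    then show ?thesis using half_arcsD(1)[OF assms(1), of i j] half_arcsD(1)[OF assms(2), of i j] by auto
  qed (use assms sym_arcs_pos(1) in metis)
  moreover have "(i, j) \<in> G \<longleftrightarrow> (i, j) \<in> G'" for i j
  proof (cases "0 < i \<and> 0 < j")
    case False
    then show ?thesis using half_arcsD(2)[OF assms(1), of i j] half_arcsD(2)[OF assms(2), of i j] by auto
  qed (use assms sym_arcs_pos(2) in metis)
  ultimately show ?thesis by auto
qed

lemma mirror_sym_arcs:
  assumes "half_arcs n F G"
  shows "mirror (sym_arcs F G) = sym_arcs F G"
  using half_arcsD(3)[OF assms] by (auto simp: mem_mirror mem_sym_arcs)

lemma partition_of_half_arcs:
  assumes H: "half_arcs n F G"
  shows "\<exists>P. partition_on (pm_set n) P \<and> arcs P = sym_arcs F G"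
proof (rule partition_with_arcs)
  show "0 \<notin> pm_set n" by (simp add: pm_set_iff)
  have bounds: "i \<in> pm_set n \<and> j \<in> pm_set n \<and> nesting_less i j" if "(i, j) \<in> sym_arcs F G" for i j
    using that half_arcsD(1)[OF H, of i j] half_arcsD(1)[OF H, of "- j" "- i"]
      half_arcsD(2)[OF H, of i "- j"]
    by (auto simp: mem_sym_arcs pm_set_iff nesting_less_def)
  then show "sym_arcs F G \<subseteq> pm_set n \<times> pm_set n" by auto
  show "nesting_less i j" if "(i, j) \<in> sym_arcs F G" for i j using bounds that by blast
  show sv: "single_valued (sym_arcs F G)"
  proof (rule single_valuedI)
    fix x y z assume *: "(x, y) \<in> sym_arcs F G" "(x, z) \<in> sym_arcs F G"
    show "y = z"
    proof (cases "0 < x")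
      case True
      have "(x, y) \<in> F \<or> (x, - y) \<in> G" "(x, z) \<in> F \<or> (x, - z) \<in> G"
        using * True half_arcsD(1)[OF H, of _ "- x"] by (force simp: mem_sym_arcs)+
      then show ?thesis using half_arcsD[OF H] by (metis neg_equal_iff_equal)
    next
      case False
      have "(- y, - x) \<in> F" "(- z, - x) \<in> F"
        using * False half_arcsD(1)[OF H, of x] half_arcsD(2)[OF H, of x] by (force simp: mem_sym_arcs)+
      then show ?thesis using half_arcsD(5)[OF H] by (metis neg_equal_iff_equal)
    qed
  qed
  show "single_valued ((sym_arcs F G)\<inverse>)"
  proof (rule single_valuedI)
    fix x y z assume "(x, y) \<in> (sym_arcs F G)\<inverse>" "(x, z) \<in> (sym_arcs F G)\<inverse>"
    then have "(- x, - y) \<in> sym_arcs F G" "(- x, - z) \<in> sym_arcs F G"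
      using mirror_sym_arcs[OF H] by (metis converseD mem_mirror minus_minus)+
    then show "y = z" using sv by (metis neg_equal_iff_equal single_valuedD)
  qed
qed

lemma half_arcs_of_partition:
  assumes P: "partition_on (pm_set n) P" and mir: "mirror (arcs P) = arcs P"
  shows "\<exists>F G. half_arcs n F G \<and> arcs P = sym_arcs F G"
proof (intro exI conjI)
  define F where "F = {(i, j). (i, j) \<in> arcs P \<and> 0 < i \<and> 0 < j}"
  define G where "G = {(i, j). (i, - j) \<in> arcs P \<and> 0 < i \<and> 0 < j}"
  have 0: "0 \<notin> pm_set n" by (simp add: pm_set_iff)
  have mem: "i \<noteq> 0 \<and> \<bar>i\<bar> \<le> int n \<and> j \<noteq> 0 \<and> \<bar>j\<bar> \<le> int n \<and> nesting_less i j"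
    if "(i, j) \<in> arcs P" for i j
    using arcs_in_carrier[OF P that] arcs_nesting_less[OF that] by (simp add: pm_set_iff)
  have rev: "(i, j) \<in> arcs P \<longleftrightarrow> (- j, - i) \<in> arcs P" for i j using mir by (metis mem_mirror)
  have sv: "j = k" if "(i, j) \<in> arcs P" "(i, k) \<in> arcs P" for i j k
    using single_valued_arcs(1)[OF P 0] that by (rule single_valuedD)
  have vs: "i = k" if "(i, j) \<in> arcs P" "(k, j) \<in> arcs P" for i j k
    using single_valued_arcs(2)[OF P 0] that by (meson converseI single_valuedD)
  show "half_arcs n F G"
    unfolding half_arcs_def
  proof (intro conjI)
    show "F \<subseteq> {(i, j). 0 < i \<and> i < j \<and> j \<le> int n}"
      using mem by (fastforce simp: F_def nesting_less_def)
    show "G \<subseteq> {1..int n} \<times> {1..int n}" using mem by (fastforce simp: G_def)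
    show "sym G"
    proof (rule symI)
      fix i j assume "(i, j) \<in> G"
      then show "(j, i) \<in> G" using rev[of i "- j"] by (simp add: G_def)
    qed
    show "single_valued F" using sv by (auto simp: F_def single_valued_def)
    show "single_valued (F\<inverse>)" using vs by (auto simp: F_def single_valued_def)
    show "single_valued G" using sv by (fastforce simp: G_def single_valued_def)
    show "Domain F \<inter> Domain G = {}" using sv by (fastforce simp: F_def G_def)
  qed
  have "(i, j) \<in> arcs P \<longleftrightarrow> (i, j) \<in> sym_arcs F G" for i j
    using mem[of i j] rev[of i j] by (auto simp: mem_sym_arcs F_def G_def nesting_less_def)
  then show "arcs P = sym_arcs F G" by auto
qed

lemma openers_half_arcs:
  assumes "partition_on (pm_set n) P" "half_arcs n F G" "arcs P = sym_arcs F G"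
  shows "openers P = Domain F \<union> Domain G"
proof -
  have "0 \<notin> pm_set n" by (simp add: pm_set_iff)
  then have "openers P = {i. i > 0 \<and> i \<in> Domain (sym_arcs F G)}"
    using openers_conv_arcs assms finite_pm_set by metis
  also have "\<dots> = Domain F \<union> Domain G"
  proof (intro equalityI subsetI)
    fix i assume "i \<in> {i. i > 0 \<and> i \<in> Domain (sym_arcs F G)}"
    then obtain j where "i > 0" "(i, j) \<in> sym_arcs F G" by blast
    then show "i \<in> Domain F \<union> Domain G"
      using half_arcsD(1)[OF assms(2), of "- j" "- i"] by (auto simp: mem_sym_arcs)
  next
    fix i assume "i \<in> Domain F \<union> Domain G"
    then consider j where "(i, j) \<in> F" | j where "(i, - (- j)) \<in> G" by auto
    then show "i \<in> {i. i > 0 \<and> i \<in> Domain (sym_arcs F G)}"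
      using half_arcsD(1,2)[OF assms(2)] mem_sym_arcs by cases blast+
  qed
  finally show ?thesis .
qed

lemma closers_half_arcs:
  assumes "partition_on (pm_set n) P" "half_arcs n F G" "arcs P = sym_arcs F G"
  shows "closers P = Range F"
proof -
  have "0 \<notin> pm_set n" by (simp add: pm_set_iff)
  then have "closers P = {i. i > 0 \<and> i \<in> Range (sym_arcs F G)}"
    using closers_conv_arcs assms finite_pm_set by metis
  also have "\<dots> = Range F"
  proof (intro equalityI subsetI)
    fix j assume "j \<in> {i. i > 0 \<and> i \<in> Range (sym_arcs F G)}"
    then obtain i where "j > 0" "(i, j) \<in> sym_arcs F G" by blast
    then show "j \<in> Range F"
      using half_arcsD(1)[OF assms(2), of "- j" "- i"] half_arcsD(2)[OF assms(2), of i "- j"]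
      by (auto simp: mem_sym_arcs)
  next
    fix j assume "j \<in> Range F"
    then obtain i where "(i, j) \<in> F" by auto
    then show "j \<in> {i. i > 0 \<and> i \<in> Range (sym_arcs F G)}"
      using half_arcsD(1)[OF assms(2)] mem_sym_arcs by fastforce
  qed
  finally show ?thesis .
qed

section \<open>Non-crossing partitions\<close>

definition interleaved :: "int \<Rightarrow> int \<Rightarrow> int \<Rightarrow> int \<Rightarrow> bool" where
  "interleaved a b a' b' \<longleftrightarrow> crossing_less a a' \<and> crossing_less a' b \<and> crossing_less b b'"

lemma arcs_cross_iff:
  "arcs_cross (p, q) (r, s) \<longleftrightarrow>
     interleaved p q r s \<or> interleaved q p r s \<or> interleaved p q s r \<or> interleaved q p s r \<or>
     interleaved r s p q \<or> interleaved s r p q \<or> interleaved r s q p \<or> interleaved s r q p"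
    (is "_ \<longleftrightarrow> ?R")
proof
  assume "arcs_cross (p, q) (r, s)"
  then obtain a b a' b' where *: "{{p, q}, {r, s}} = {{a, b}, {a', b'}}" "interleaved a b a' b'"
    by (auto simp: arcs_cross_def ends_def interleaved_def)
  then have "{p, q} = {a, b} \<and> {r, s} = {a', b'} \<or> {p, q} = {a', b'} \<and> {r, s} = {a, b}"
    by (subst (asm) doubleton_eq_iff)
  then show ?R using *(2) unfolding doubleton_eq_iff by (elim disjE conjE) simp_all
next
  have "arcs_cross (p, q) (r, s)"
    if "interleaved a b a' b'" "{{p, q}, {r, s}} = {{a, b}, {a', b'}}" for a b a' b'
    unfolding arcs_cross_def ends_def using that by (auto simp: interleaved_def)
  then show "?R \<Longrightarrow> arcs_cross (p, q) (r, s)"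
    by (elim disjE) (auto simp: insert_commute)
qed

lemma arcs_cross_commute: "arcs_cross \<alpha> \<beta> \<longleftrightarrow> arcs_cross \<beta> \<alpha>"
  by (simp add: arcs_cross_def insert_commute)

lemma cross_positive_positive:
  "0 < a \<Longrightarrow> a < b \<Longrightarrow> 0 < c \<Longrightarrow> c < d \<Longrightarrow>
   arcs_cross (a, b) (c, d) \<longleftrightarrow> a < c \<and> c < b \<and> b < d \<or> c < a \<and> a < d \<and> d < b"
  by (auto simp: arcs_cross_iff interleaved_def crossing_less_def)

lemma cross_negative_negative:
  "0 < a \<Longrightarrow> a < b \<Longrightarrow> 0 < c \<Longrightarrow> c < d \<Longrightarrow>
   arcs_cross (- b, - a) (- d, - c) \<longleftrightarrow> a < c \<and> c < b \<and> b < d \<or> c < a \<and> a < d \<and> d < b"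
  by (auto simp: arcs_cross_iff interleaved_def crossing_less_def)

lemma cross_positive_negative:
  "0 < a \<Longrightarrow> a < b \<Longrightarrow> 0 < c \<Longrightarrow> c < d \<Longrightarrow> \<not> arcs_cross (a, b) (- d, - c)"
  by (auto simp: arcs_cross_iff interleaved_def crossing_less_def)

lemma cross_positive_central:
  "0 < a \<Longrightarrow> a < b \<Longrightarrow> 0 < i \<Longrightarrow> 0 < j \<Longrightarrow> arcs_cross (a, b) (i, - j) \<longleftrightarrow> a < i \<and> i < b"
  by (auto simp: arcs_cross_iff interleaved_def crossing_less_def)

lemma cross_negative_central:
  "0 < a \<Longrightarrow> a < b \<Longrightarrow> 0 < i \<Longrightarrow> 0 < j \<Longrightarrow> arcs_cross (- b, - a) (i, - j) \<longleftrightarrow> a < j \<and> j < b"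
  by (auto simp: arcs_cross_iff interleaved_def crossing_less_def)

lemma cross_central_central:
  "0 < i \<Longrightarrow> 0 < j \<Longrightarrow> 0 < k \<Longrightarrow> 0 < l \<Longrightarrow>
   arcs_cross (i, - j) (k, - l) \<longleftrightarrow> i < k \<and> j < l \<or> k < i \<and> l < j"
  by (auto simp: arcs_cross_iff interleaved_def crossing_less_def)

text \<open>
Each zero block contains some arc \<open>(i, - i)\<close>. If only \<open>i = n\<close> is possible, all zero blocks contain
\<open>n\<close> and hence coincide. As \<open>n\<close> and \<open>- n\<close> are then consecutive, such a block has a further element
iff \<open>n\<close> has a predecessor.
\<close>

lemma set_partition_D_iff:
  assumes P: "partition_on (pm_set n) P" and mir: "mirror (arcs P) = arcs P" and "n \<ge> 1"
    and only: "\<And>i. (i, - i) \<in> arcs P \<Longrightarrow> i = int n"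
  shows "set_partition_D n P \<longleftrightarrow> ((int n, - int n) \<in> arcs P \<longrightarrow> int n \<in> closers P)"
proof -
  have neg: "B \<in> P \<longleftrightarrow> uminus ` B \<in> P" for B
    using negated_blocks_iff_mirror_arcs[OF P] mir by blast
  have same: "B = C" if "B \<in> P" "C \<in> P" "x \<in> B" "x \<in> C" for B C x
    using that partition_onD2[OF P] by (auto simp: disjoint_def)
  have sub: "B \<subseteq> pm_set n" "B \<noteq> {}" if "B \<in> P" for B
    using P that by (auto simp: partition_on_def)
  have zero: "int n \<in> B \<and> (int n, - int n) \<in> arcs P" if "B \<in> P" "B = uminus ` B" for B
  proof -
    have "finite B" "0 \<notin> B" using sub(1)[OF that(1)] finite_pm_set[of n]
      by (auto intro: finite_subset simp: pm_set_iff)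
    then show ?thesis using zero_block_arc[OF that _ _ sub(2)[OF that(1)]] only by blast
  qed
  have C: "set_partition_C n P"
    unfolding set_partition_C_def using P neg zero same by blast
  have "(\<forall>B\<in>P. B = uminus ` B \<longrightarrow> \<not> (\<exists>i. B = {i, - i})) \<longleftrightarrow>
    ((int n, - int n) \<in> arcs P \<longrightarrow> int n \<in> closers P)"
  proof
    assume D: "\<forall>B\<in>P. B = uminus ` B \<longrightarrow> \<not> (\<exists>i. B = {i, - i})"
    show "(int n, - int n) \<in> arcs P \<longrightarrow> int n \<in> closers P"
    proof
      assume "(int n, - int n) \<in> arcs P"
      then obtain B where B: "B \<in> P" "int n \<in> B" "- int n \<in> B" by (auto simp: arcs_def)
      have "int n \<in> uminus ` B" using B(3) by (simp add: uminus_image_iff)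
      then have sym: "B = uminus ` B" using same neg B by blast
      then have "B \<noteq> {int n, - int n}" using D B(1) by blast
      then obtain m where m: "m \<in> B" "m \<noteq> int n" "m \<noteq> - int n" using B by blast
      have "- m \<in> B" using m(1) sym uminus_image_iff by metis
      then have "\<bar>m\<bar> \<in> B" using m(1) by (simp add: abs_if)
      moreover have "nesting_less \<bar>m\<bar> (int n)"
        using subsetD[OF sub(1)[OF B(1)] m(1)] m(2,3) \<open>n \<ge> 1\<close>
        by (auto simp: pm_set_iff nesting_less_def)
      ultimately show "int n \<in> closers P" using B \<open>n \<ge> 1\<close> by (auto simp: closers_def)
    qed
  next
    assume cl: "(int n, - int n) \<in> arcs P \<longrightarrow> int n \<in> closers P"
    show "\<forall>B\<in>P. B = uminus ` B \<longrightarrow> \<not> (\<exists>i. B = {i, - i})"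
    proof (intro ballI impI notI)
      fix B assume B: "B \<in> P" "B = uminus ` B" "\<exists>i. B = {i, - i}"
      have n: "int n \<in> B" "int n \<in> closers P" using zero[OF B(1,2)] cl by auto
      then have eq: "B = {int n, - int n}" using B(3) by auto
      obtain C j where "C \<in> P" "int n \<in> C" "j \<in> C" "nesting_less j (int n)"
        using n(2) by (auto simp: closers_def)
      then have "j \<in> {int n, - int n}" "nesting_less j (int n)" using same B(1) n(1) eq by blast+
      then show False by (auto simp: nesting_less_def)
    qed
  qed
  then show ?thesis using C by (simp add: set_partition_D_def)
qed

text \<open>
The central arcs, that is, the part of \<open>G\<close> that does not involve \<open>n\<close> or \<open>- n\<close>.
\<close>

definition core :: "nat \<Rightarrow> (int \<times> int) set \<Rightarrow> (int \<times> int) set" where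
  "core n G = {(i, j) \<in> G. i < int n \<and> j < int n}"

text \<open>
In the first condition, the arc ending in \<open>n\<close> is left out because it may cover openers: it has to
cross the upper central arcs. Which of the central arcs it crosses is governed by the last
condition, which also deals with the arc from \<open>x\<close> to \<open>- n\<close>.
\<close>

definition noncrossing_halves :: "nat \<Rightarrow> (int \<times> int) set \<Rightarrow> (int \<times> int) set \<Rightarrow> bool" where
  "noncrossing_halves n F G \<longleftrightarrow>
     well_nested (Domain F \<union> Domain G) {(a, b) \<in> F. b < int n} \<and>
     (\<forall>i. (i, i) \<in> G \<longrightarrow> i = int n) \<and> ((int n, int n) \<in> G \<longrightarrow> int n \<in> Range F) \<and>
     (\<forall>(i, j) \<in> core n G. \<forall>(i', j') \<in> core n G. \<not> (i < i' \<and> j < j')) \<and>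
     (\<forall>x. (x, int n) \<in> F \<union> G \<and> x \<noteq> int n \<longrightarrow> separates (Domain (core n G)) x)"

lemma core_half_arcs:
  assumes "half_arcs n F G"
  shows "finite (Domain (core n G))" "sym (core n G)" "single_valued (core n G)"
proof -
  have "Domain (core n G) \<subseteq> {1..int n}" using half_arcsD(2)[OF assms] by (force simp: core_def)
  then show "finite (Domain (core n G))" by (rule finite_subset) simp
  show "sym (core n G)" using half_arcsD(3)[OF assms] by (auto simp: core_def sym_def)
  show "single_valued (core n G)" using assms by (auto simp: core_def half_arcs_def single_valued_def)
qed

text \<open>
A core of odd size would have a fixed point \<open>i\<close>, that is, there would be an arc \<open>(i, - i)\<close> with
\<open>i < n\<close>.
\<close>

lemma core_eq_reversal:
  assumes "half_arcs n F G" "noncrossing_halves n F G"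
  shows "core n G = reversal (Domain (core n G))" "even (card (Domain (core n G)))"
proof -
  show eq: "core n G = reversal (Domain (core n G))"
  proof (rule reversal_unique)
    show "\<not> (i < i' \<and> j < j')" if "(i, j) \<in> core n G" "(i', j') \<in> core n G" for i j i' j'
      using assms(2) that unfolding noncrossing_halves_def by blast
  qed (use core_half_arcs[OF assms(1)] in auto)
  have "\<forall>i. (i, i) \<in> G \<longrightarrow> i = int n" using assms(2) by (simp add: noncrossing_halves_def)
  then have "(i, i) \<notin> core n G" for i by (auto simp: core_def)
  then show "even (card (Domain (core n G)))"
    using reversal_fixed_point_iff[OF core_half_arcs(1)[OF assms(1)]] eq by metis
qed

lemma central_arcs_half_arcs:
  assumes H: "half_arcs n F G" and A: "arcs P = sym_arcs F G"
  shows "(i, j) \<in> central_arcs n P \<longleftrightarrow> (i, - j) \<in> core n G"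
  using half_arcsD(1)[OF H, of i j] half_arcsD(1)[OF H, of "- j" "- i"]
    half_arcsD(2)[OF H, of i "- j"]
  by (auto simp: central_arcs_def core_def A mem_sym_arcs)

text \<open>
Distinct central arcs start in distinct elements, so the rank of an arc among the central arcs is
the rank of its starting point in the domain of the core.
\<close>

lemma upper_central_arcs_half_arcs:
  assumes H: "half_arcs n F G" and A: "arcs P = sym_arcs F G"
  defines "K \<equiv> Domain (core n G)"
  defines "up \<equiv> \<lambda>i. card K < 2 * card {u \<in> K. u \<le> i}"
  shows "(i, j) \<in> upper_central_arcs n P \<longleftrightarrow> (i, - j) \<in> core n G \<and> up i"
    and "(i, j) \<in> lower_central_arcs n P \<longleftrightarrow> (i, - j) \<in> core n G \<and> \<not> up i"
proof -
  have *: "card {\<beta> \<in> central_arcs n P. Q (fst \<beta>)} = card {u \<in> K. Q u}" for Q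
  proof (rule bij_betw_same_card[of fst], rule bij_betw_imageI)
    show "inj_on fst {\<beta> \<in> central_arcs n P. Q (fst \<beta>)}"
    proof (rule inj_onI, clarsimp)
      fix u y z assume "(u, y) \<in> central_arcs n P" "(u, z) \<in> central_arcs n P"
      then have "- y = - z"
        using core_half_arcs(3)[OF H] central_arcs_half_arcs[OF H A] by (metis single_valuedD)
      then show "y = z" by simp
    qed
    have "\<exists>y. (u, y) \<in> central_arcs n P" if "u \<in> K" for u
    proof -
      obtain y where "(u, y) \<in> core n G" using \<open>u \<in> K\<close> by (auto simp: K_def)
      then have "(u, - y) \<in> central_arcs n P" by (simp add: central_arcs_half_arcs[OF H A])
      then show ?thesis by blast
    qed
    moreover have "u \<in> K" if "(u, y) \<in> central_arcs n P" for u y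
      using that by (auto simp: K_def central_arcs_half_arcs[OF H A])
    ultimately show "fst ` {\<beta> \<in> central_arcs n P. Q (fst \<beta>)} = {u \<in> K. Q u}" by force
  qed
  show "(i, j) \<in> upper_central_arcs n P \<longleftrightarrow> (i, - j) \<in> core n G \<and> up i"
    and "(i, j) \<in> lower_central_arcs n P \<longleftrightarrow> (i, - j) \<in> core n G \<and> \<not> up i"
    using *[of "\<lambda>_. True"] *[of "\<lambda>u. u \<le> i"]
    by (auto simp: upper_central_arcs_def lower_central_arcs_def central_index_def up_def
        central_arcs_half_arcs[OF H A])
qed

lemma noncrossing_halvesD:
  assumes "noncrossing_halves n F G"
  defines "K \<equiv> Domain (core n G)"
  shows "(a, b) \<in> F \<Longrightarrow> b < int n \<Longrightarrow> c \<in> Domain F \<union> Domain G \<Longrightarrow> a < c \<Longrightarrow> c < b \<Longrightarrow> \<exists>d<b. (c, d) \<in> F"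
    and "(i, i) \<in> G \<Longrightarrow> i = int n"
    and "(int n, int n) \<in> G \<Longrightarrow> int n \<in> Range F"
    and "(i, j) \<in> core n G \<Longrightarrow> (i', j') \<in> core n G \<Longrightarrow> i < i' \<Longrightarrow> \<not> j < j'"
    and "(x, int n) \<in> F \<union> G \<Longrightarrow> x \<noteq> int n \<Longrightarrow> (i, j) \<in> core n G \<Longrightarrow>
      x < i \<longleftrightarrow> card K < 2 * card {u \<in> K. u \<le> i}"
proof -
  have nest: "well_nested (Domain F \<union> Domain G) {(a, b) \<in> F. b < int n}"
    and diag: "\<forall>i. (i, i) \<in> G \<longrightarrow> i = int n" "(int n, int n) \<in> G \<longrightarrow> int n \<in> Range F"
    and dec: "\<forall>(i, j) \<in> core n G. \<forall>(i', j') \<in> core n G. \<not> (i < i' \<and> j < j')"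
    and sep: "\<forall>x. (x, int n) \<in> F \<union> G \<and> x \<noteq> int n \<longrightarrow> separates K x"
    using assms(1) unfolding noncrossing_halves_def K_def by blast+
  show "\<exists>d<b. (c, d) \<in> F"
    if ab: "(a, b) \<in> F" "b < int n" and c: "c \<in> Domain F \<union> Domain G" "a < c" "c < b"
  proof -
    have "(a, b) \<in> {(a, b) \<in> F. b < int n}" using ab by simp
    then obtain d where "d < b" "(c, d) \<in> {(a, b) \<in> F. b < int n}"
      by (rule well_nestedD[OF nest _ c])
    then show ?thesis by auto
  qed
  show "(i, i) \<in> G \<Longrightarrow> i = int n" "(int n, int n) \<in> G \<Longrightarrow> int n \<in> Range F"
    using diag by blast+
  show "(i, j) \<in> core n G \<Longrightarrow> (i', j') \<in> core n G \<Longrightarrow> i < i' \<Longrightarrow> \<not> j < j'"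
    using dec by blast
  show "(x, int n) \<in> F \<union> G \<Longrightarrow> x \<noteq> int n \<Longrightarrow> (i, j) \<in> core n G \<Longrightarrow>
      x < i \<longleftrightarrow> card K < 2 * card {u \<in> K. u \<le> i}"
    using sep unfolding separates_def K_def by blast
qed

text \<open>
None of the exceptions concerns arcs that avoid \<open>n\<close> and \<open>- n\<close>, which yields the conditions on
nesting below \<open>n\<close> and on the core. An arc \<open>(x, n)\<close> crosses \<open>(i, - j)\<close> iff \<open>x < i\<close>, and \<open>(x, - n)\<close> does iff
\<open>i < x\<close>; as the former has to cross exactly the upper and the latter exactly the lower central
arcs, \<open>x\<close> separates the halves in both cases.
\<close>

lemma noncrossing_halves_if_noncrossing_D:
  assumes "n \<ge> 1" and P: "partition_on (pm_set n) P" and H: "half_arcs n F G"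
    and A: "arcs P = sym_arcs F G" and NC: "noncrossing_D n P"
  shows "noncrossing_halves n F G"
proof -
  note h = half_arcsD[OF H]
  have F_arc: "(a, b) \<in> arcs P" if "(a, b) \<in> F" for a b
    using that by (simp add: A mem_sym_arcs)
  have G_arc: "(i, - j) \<in> arcs P" if "(i, j) \<in> G" for i j
    using that by (simp add: A mem_sym_arcs)
  have coreD: "(i, j) \<in> G \<and> 0 < i \<and> i < int n \<and> 0 < j \<and> j < int n" if "(i, j) \<in> core n G" for i j
    using that h(2) by (auto simp: core_def)
  define K where "K = Domain (core n G)"
  define up where "up i \<longleftrightarrow> card K < 2 * card {u \<in> K. u \<le> i}" for i
  have upper: "(i, j) \<in> upper_central_arcs n P \<longleftrightarrow> (i, - j) \<in> core n G \<and> up i"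
    and lower: "(i, j) \<in> lower_central_arcs n P \<longleftrightarrow> (i, - j) \<in> core n G \<and> \<not> up i" for i j
    unfolding up_def K_def by (rule upper_central_arcs_half_arcs[OF H A])+
  have D: "set_partition_D n P" and only: "\<forall>i. (i, - i) \<in> arcs P \<longrightarrow> i = int n"
    and must_up: "\<And>\<alpha> \<beta>. \<alpha> \<in> arcs P \<Longrightarrow> int n \<in> ends \<alpha> \<Longrightarrow> \<beta> \<in> upper_central_arcs n P \<Longrightarrow> arcs_cross \<alpha> \<beta>"
    and must_lo: "\<And>\<alpha> \<beta>. \<alpha> \<in> arcs P \<Longrightarrow> - int n \<in> ends \<alpha> \<Longrightarrow> \<beta> \<in> lower_central_arcs n P \<Longrightarrow> arcs_cross \<alpha> \<beta>"
    and cross: "\<And>\<alpha> \<beta>. \<alpha> \<in> arcs P \<Longrightarrow> \<beta> \<in> arcs P \<Longrightarrow> arcs_cross \<alpha> \<beta> \<Longrightarrow>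
      allowed_crossing n P \<alpha> \<beta> \<or> allowed_crossing n P \<beta> \<alpha>"
    using NC unfolding noncrossing_D_def by blast+
  show ?thesis
    unfolding noncrossing_halves_def
  proof (intro conjI)
    show "well_nested (Domain F \<union> Domain G) {(a, b) \<in> F. b < int n}"
    proof (rule well_nestedI)
      fix a b c assume ab': "(a, b) \<in> {(a, b) \<in> F. b < int n}" and c: "c \<in> Domain F \<union> Domain G" "a < c" "c < b"
      have ab: "(a, b) \<in> F" "b < int n" "0 < a" "a < b" using ab' h(1)[of a b] by auto
      have "\<exists>d<b. (c, d) \<in> F"
      proof (rule ccontr)
        assume none: "\<nexists>d. d < b \<and> (c, d) \<in> F"
        from c(1) consider d where "(c, d) \<in> F" | d where "(c, d) \<in> G" by blast
        then show False
        proof cases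
          case 1
          then have "b < d" using none h(5)[OF ab(1), of c] c by (metis less_irrefl linorder_neqE)
          moreover have "0 < c" "c < d" using h(1)[OF 1] by auto
          ultimately have "arcs_cross (a, b) (c, d)"
            using ab c by (simp add: cross_positive_positive)
          from cross[OF F_arc[OF ab(1)] F_arc[OF 1] this] show False
            using ab c coreD[of c "- d"] coreD[of a "- b"] \<open>b < d\<close>
            by (auto simp: allowed_crossing_def ends_def upper lower)
        next
          case 2
          then have "0 < d" "0 < c" using h(2) by auto
          then have "arcs_cross (a, b) (c, - d)" using ab c by (simp add: cross_positive_central)
          from cross[OF F_arc[OF ab(1)] G_arc[OF 2] this] show False
            using ab c coreD[of a "- b"] \<open>0 < d\<close> by (auto simp: allowed_crossing_def ends_def upper lower)
        qed
      qed
      then show "\<exists>d<b. (c, d) \<in> {(a, b) \<in> F. b < int n}" using ab by auto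
    qed
    show "\<forall>i. (i, i) \<in> G \<longrightarrow> i = int n" using only G_arc by blast
    show "(int n, int n) \<in> G \<longrightarrow> int n \<in> Range F"
    proof
      assume "(int n, int n) \<in> G"
      moreover have "mirror (arcs P) = arcs P" using A mirror_sym_arcs[OF H] by simp
      ultimately show "int n \<in> Range F"
        using set_partition_D_iff[OF P _ \<open>n \<ge> 1\<close>] only D G_arc closers_half_arcs[OF P H A] by blast
    qed
    have "\<not> (i < i' \<and> j < j')" if "(i, j) \<in> core n G" "(i', j') \<in> core n G" for i j i' j'
    proof
      assume "i < i' \<and> j < j'"
      then have "arcs_cross (i, - j) (i', - j')"
        using coreD[OF that(1)] coreD[OF that(2)] by (simp add: cross_central_central)
      moreover have "(i, j) \<in> G" "(i', j') \<in> G" using that by (auto simp: core_def)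
      ultimately have "allowed_crossing n P (i, - j) (i', - j') \<or> allowed_crossing n P (i', - j') (i, - j)"
        using cross G_arc by blast
      then show False
        using coreD[OF that(1)] coreD[OF that(2)] by (auto simp: allowed_crossing_def ends_def)
    qed
    then show "\<forall>(i, j) \<in> core n G. \<forall>(i', j') \<in> core n G. \<not> (i < i' \<and> j < j')" by blast
    have "x < i \<longleftrightarrow> up i"
      if x: "(x, int n) \<in> F \<union> G" "x \<noteq> int n" and ij: "(i, j) \<in> core n G" for x i j
    proof -
      note c = coreD[OF ij]
      have ij_arc: "(i, - j) \<in> arcs P" using c G_arc by blast
      from x(1) show ?thesis
      proof
        assume F: "(x, int n) \<in> F"
        then have bx: "0 < x" "x < int n" using h(1) by auto
        have cr: "arcs_cross (x, int n) (i, - j) \<longleftrightarrow> x < i"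
          using bx c by (simp add: cross_positive_central)
        show ?thesis
        proof
          assume "x < i"
          from cross[OF F_arc[OF F] ij_arc] this cr show "up i"
            using c bx by (auto simp: allowed_crossing_def ends_def upper lower)
        next
          assume "up i"
          then have "(i, - j) \<in> upper_central_arcs n P" using ij by (simp add: upper)
          then show "x < i" using must_up[OF F_arc[OF F]] cr by (simp add: ends_def)
        qed
      next
        assume G: "(x, int n) \<in> G"
        then have bx: "0 < x" "x < int n" using h(2)[OF G] x(2) by auto
        have cr: "arcs_cross (x, - int n) (i, - j) \<longleftrightarrow> i < x"
          using bx c by (auto simp: cross_central_central)
        have "x \<noteq> i" using h(6)[of x "int n" j] G c by auto
        have "i < x \<longleftrightarrow> \<not> up i"
        proof
          assume "i < x"
          from cross[OF G_arc[OF G] ij_arc] this cr show "\<not> up i"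
            using c bx by (auto simp: allowed_crossing_def ends_def upper lower)
        next
          assume "\<not> up i"
          then have "(i, - j) \<in> lower_central_arcs n P" using ij by (simp add: lower)
          then show "i < x" using must_lo[OF G_arc[OF G]] cr by (simp add: ends_def)
        qed
        then show ?thesis using \<open>x \<noteq> i\<close> by auto
      qed
    qed
    then show "\<forall>x. (x, int n) \<in> F \<union> G \<and> x \<noteq> int n \<longrightarrow> separates (Domain (core n G)) x"
      unfolding separates_def up_def K_def by blast
  qed
qed

text \<open>
The last condition of \<open>noncrossing_halves\<close> directly controls the arcs \<open>(x, n)\<close> and \<open>(x, - n)\<close>. For
their mirror images \<open>(- n, - x)\<close> and \<open>(n, - x)\<close> one passes to the mirrored central arc, which
lies in the opposite half.
\<close>

lemma noncrossing_D_if_noncrossing_halves: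
  assumes "n \<ge> 1" and P: "partition_on (pm_set n) P" and H: "half_arcs n F G"
    and A: "arcs P = sym_arcs F G" and NC: "noncrossing_halves n F G"
  shows "noncrossing_D n P"
proof -
  note h = half_arcsD[OF H] and nc = noncrossing_halvesD[OF NC]
  define K where "K = Domain (core n G)"
  define up where "up i \<longleftrightarrow> card K < 2 * card {u \<in> K. u \<le> i}" for i
  have upper: "(i, j) \<in> upper_central_arcs n P \<longleftrightarrow> (i, - j) \<in> core n G \<and> up i"
    and lower: "(i, j) \<in> lower_central_arcs n P \<longleftrightarrow> (i, - j) \<in> core n G \<and> \<not> up i" for i j
    unfolding up_def K_def by (rule upper_central_arcs_half_arcs[OF H A])+
  have coreD: "(i, j) \<in> G \<and> 0 < i \<and> i < int n \<and> 0 < j \<and> j < int n" if "(i, j) \<in> core n G" for i j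
    using that h(2) by (auto simp: core_def)
  have core_sym: "(j, i) \<in> core n G" if "(i, j) \<in> core n G" for i j
    using that h(3) by (auto simp: core_def)
  have sep: "x < i \<longleftrightarrow> up i"
    if "(x, int n) \<in> F \<union> G" "x \<noteq> int n" "(i, j) \<in> core n G" for x i j
    using nc(5)[OF that] by (simp add: up_def K_def)
  have flip: "up j \<longleftrightarrow> \<not> up i" if "(i, j) \<in> core n G" for i j
    unfolding up_def K_def
    using core_half_arcs(1)[OF H] core_eq_reversal[OF H NC] that by (intro reversal_swaps_halves) auto
  have arc_cases: "(\<exists>a b. \<alpha> = (a, b) \<and> (a, b) \<in> F) \<or> (\<exists>a b. \<alpha> = (- b, - a) \<and> (a, b) \<in> F) \<or>
      (\<exists>i j. \<alpha> = (i, - j) \<and> (i, j) \<in> G)" if "\<alpha> \<in> arcs P" for \<alpha>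
  proof -
    obtain x y where xy: "\<alpha> = (x, y)" by fastforce
    then have "(x, y) \<in> F \<or> (- y, - x) \<in> F \<or> (x, - y) \<in> G" using that by (simp add: A mem_sym_arcs)
    then show ?thesis unfolding xy by (metis minus_minus)
  qed
  have only: "i = int n" if "(i, - i) \<in> arcs P" for i
    using that nc(2)[of i] h(1)[of i "- i"] by (auto simp: A mem_sym_arcs)
  have "int n \<in> closers P" if "(int n, - int n) \<in> arcs P"
  proof -
    have "(int n, int n) \<in> G" using that h(1)[of "int n" "- int n"] by (auto simp: A mem_sym_arcs)
    then show ?thesis using nc(3) closers_half_arcs[OF P H A] by blast
  qed
  moreover have "mirror (arcs P) = arcs P" using A mirror_sym_arcs[OF H] by simp
  ultimately have D: "set_partition_D n P"
    using set_partition_D_iff[OF P _ \<open>n \<ge> 1\<close>] only by blast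
  have must_up: "arcs_cross \<alpha> \<beta>"
    if \<alpha>: "\<alpha> \<in> arcs P" "int n \<in> ends \<alpha>" and \<beta>: "\<beta> \<in> upper_central_arcs n P" for \<alpha> \<beta>
  proof -
    obtain i j where ij: "\<beta> = (i, - j)" "(i, j) \<in> core n G" "up i"
      using \<beta> upper by (metis minus_minus surj_pair)
    note c = coreD[OF ij(2)]
    from arc_cases[OF \<alpha>(1)] consider a b where "\<alpha> = (a, b)" "(a, b) \<in> F"
      | a b where "\<alpha> = (- b, - a)" "(a, b) \<in> F" | k l where "\<alpha> = (k, - l)" "(k, l) \<in> G" by blast
    then show ?thesis
    proof cases
      case 1
      then have "b = int n" "0 < a" "a < int n" using \<alpha>(2) h(1)[OF 1(2)] by (auto simp: ends_def)
      then show ?thesis using 1 ij c sep[of a i j] by (simp add: cross_positive_central)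
    next
      case 2
      then show ?thesis using \<alpha>(2) h(1)[OF 2(2)] by (auto simp: ends_def)
    next
      case 3
      then have k: "k = int n" "0 < l" "l \<le> int n" using \<alpha>(2) h(2)[OF 3(2)] by (auto simp: ends_def)
      have "j < l"
      proof (cases "l = int n")
        case False
        have "(l, int n) \<in> G" using h(3)[OF 3(2)] k by simp
        then have "l \<noteq> j" "\<not> l < j"
          using sep[OF _ False core_sym[OF ij(2)]] flip[OF ij(2)] ij(3) h(6)[of l "int n" i] c h(3)[of i j]
          by auto
        then show ?thesis by simp
      qed (use c in simp)
      then show ?thesis using 3 ij c k by (simp add: cross_central_central)
    qed
  qed
  have must_lo: "arcs_cross \<alpha> \<beta>"
    if \<alpha>: "\<alpha> \<in> arcs P" "- int n \<in> ends \<alpha>" and \<beta>: "\<beta> \<in> lower_central_arcs n P" for \<alpha> \<beta>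
  proof -
    obtain i j where ij: "\<beta> = (i, - j)" "(i, j) \<in> core n G" "\<not> up i"
      using \<beta> lower by (metis minus_minus surj_pair)
    note c = coreD[OF ij(2)]
    from arc_cases[OF \<alpha>(1)] consider a b where "\<alpha> = (a, b)" "(a, b) \<in> F"
      | a b where "\<alpha> = (- b, - a)" "(a, b) \<in> F" | k l where "\<alpha> = (k, - l)" "(k, l) \<in> G" by blast
    then show ?thesis
    proof cases
      case 1
      then show ?thesis using \<alpha>(2) h(1)[OF 1(2)] by (auto simp: ends_def)
    next
      case 2
      then have ab: "b = int n" "0 < a" "a < int n" using \<alpha>(2) h(1)[OF 2(2)] by (auto simp: ends_def)
      then have "a < j" using 2 sep[of a j i] core_sym[OF ij(2)] flip[OF ij(2)] ij(3) by simp
      then show ?thesis using 2 ij c ab cross_negative_central[of a b i j] by simp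
    next
      case 3
      then have k: "l = int n" "0 < k" "k \<le> int n" using \<alpha>(2) h(2)[OF 3(2)] by (auto simp: ends_def)
      have "i < k"
      proof (cases "k = int n")
        case False
        have "(k, int n) \<in> G" using 3 k by simp
        then have "k \<noteq> i" "\<not> k < i" using sep[OF _ False ij(2)] ij(3) h(6)[of k "int n" j] c by auto
        then show ?thesis by simp
      qed (use c in simp)
      then show ?thesis using 3 ij c k by (simp add: cross_central_central)
    qed
  qed
  \<comment> \<open>It remains to check all pairs of arcs; \<open>F\<close>, \<open>M\<close> and \<open>G\<close> in the names of the cases below stand
    for arcs between positive elements, their mirror images, and arcs that change the sign.\<close>
  define ok where "ok \<alpha> \<beta> \<longleftrightarrow>
    (arcs_cross \<alpha> \<beta> \<longrightarrow> allowed_crossing n P \<alpha> \<beta> \<or> allowed_crossing n P \<beta> \<alpha>)" for \<alpha> \<beta>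
  have ok_sym: "ok \<alpha> \<beta> \<longleftrightarrow> ok \<beta> \<alpha>" for \<alpha> \<beta>
    unfolding ok_def using arcs_cross_commute by blast
  have no_FF: "\<not> (a < c \<and> c < b \<and> b < d)" if ab: "(a, b) \<in> F" and cd: "(c, d) \<in> F" for a b c d
  proof
    assume *: "a < c \<and> c < b \<and> b < d"
    then have "b < int n" using h(1)[OF cd] by simp
    then obtain e where "e < b" "(c, e) \<in> F" using nc(1)[OF ab, of c] cd * by blast
    then show False using h(4)[OF cd] * by force
  qed
  have no_FG: "b = int n" if ab: "(a, b) \<in> F" and i: "i \<in> Domain G" "a < i" "i < b" for a b i
  proof (rule ccontr)
    assume "b \<noteq> int n"
    then have "b < int n" using h(1)[OF ab] by simp
    then obtain d where "(i, d) \<in> F" using nc(1)[OF ab] i by blast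
    then show False using h(8) i(1) by blast
  qed
  have FF: "ok (a, b) (c, d)" if "(a, b) \<in> F" "(c, d) \<in> F" for a b c d
    using no_FF[OF that] no_FF[OF that(2,1)] h(1)[OF that(1)] h(1)[OF that(2)]
    by (auto simp: ok_def cross_positive_positive)
  have MM: "ok (- b, - a) (- d, - c)" if "(a, b) \<in> F" "(c, d) \<in> F" for a b c d
    using no_FF[OF that] no_FF[OF that(2,1)] h(1)[OF that(1)] h(1)[OF that(2)]
      cross_negative_negative[of a b c d] by (auto simp: ok_def)
  have FM: "ok (a, b) (- d, - c)" if "(a, b) \<in> F" "(c, d) \<in> F" for a b c d
    using h(1)[OF that(1)] h(1)[OF that(2)] cross_positive_negative[of a b c d] by (auto simp: ok_def)
  have FG: "ok (a, b) (i, - j)" if "(a, b) \<in> F" "(i, j) \<in> G" for a b i j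
    unfolding ok_def
  proof
    assume "arcs_cross (a, b) (i, - j)"
    then have ai: "a < i" "i < b" using h(1)[OF that(1)] h(2)[OF that(2)]
      by (auto simp: cross_positive_central)
    then have b: "b = int n" using no_FG that by blast
    show "allowed_crossing n P (a, b) (i, - j) \<or> allowed_crossing n P (i, - j) (a, b)"
    proof (cases "j = int n")
      case False
      then have ij: "(i, j) \<in> core n G" using that(2) h(2)[OF that(2)] ai b by (simp add: core_def)
      then have "up i" using sep[of a i j] that(1) b ai h(1)[OF that(1)] by auto
      then show ?thesis using ij b by (simp add: allowed_crossing_def ends_def upper)
    qed (use b in \<open>simp add: allowed_crossing_def ends_def\<close>)
  qed
  have MG: "ok (- b, - a) (i, - j)" if "(a, b) \<in> F" "(i, j) \<in> G" for a b i j
    unfolding ok_def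
  proof
    assume "arcs_cross (- b, - a) (i, - j)"
    then have aj: "a < j" "j < b" using h(1)[OF that(1)] h(2)[OF that(2)]
      cross_negative_central[of a b i j] by auto
    then have b: "b = int n" using no_FG[OF that(1), of j] h(3)[OF that(2)] by blast
    show "allowed_crossing n P (- b, - a) (i, - j) \<or> allowed_crossing n P (i, - j) (- b, - a)"
    proof (cases "i = int n")
      case False
      then have ij: "(i, j) \<in> core n G" using that(2) h(2)[OF that(2)] aj b by (simp add: core_def)
      then have "\<not> up i" using sep[of a j i] core_sym flip[OF ij] that(1) b aj h(1)[OF that(1)] by auto
      then show ?thesis using ij b by (simp add: allowed_crossing_def ends_def lower)
    qed (use b in \<open>simp add: allowed_crossing_def ends_def\<close>)
  qed
  have GG': "allowed_crossing n P (k, - l) (i, - j)"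
    if "(i, j) \<in> G" "(k, l) \<in> G" "i < k" "j < l" for i j k l
  proof -
    have bounds: "k \<le> int n" "l \<le> int n" using h(2)[OF that(2)] by auto
    then have ij: "(i, j) \<in> core n G" using that by (simp add: core_def)
    have "\<not> (k < int n \<and> l < int n)" using nc(4)[OF ij, of k l] that by (auto simp: core_def)
    then consider "k = int n" "l = int n" | "k = int n" "l < int n" | "k < int n" "l = int n"
      using bounds by linarith
    then show ?thesis
    proof cases
      case 1
      then show ?thesis using ij by (auto simp: allowed_crossing_def ends_def upper lower)
    next
      case 2
      then have "(l, int n) \<in> G" using h(3)[OF that(2)] by simp
      then have "up i" using sep[of l j i] core_sym[OF ij] flip[OF ij] 2 that(4) by auto
      then show ?thesis using ij 2 by (auto simp: allowed_crossing_def ends_def upper)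
    next
      case 3
      then have "\<not> up i" using sep[of k i j] ij that by auto
      then show ?thesis using ij 3 by (auto simp: allowed_crossing_def ends_def lower)
    qed
  qed
  have GG: "ok (i, - j) (k, - l)" if "(i, j) \<in> G" "(k, l) \<in> G" for i j k l
    using GG'[OF that] GG'[OF that(2,1)] h(2)[OF that(1)] h(2)[OF that(2)]
    by (auto simp: ok_def cross_central_central)
  have "ok \<alpha> \<beta>" if "\<alpha> \<in> arcs P" "\<beta> \<in> arcs P" for \<alpha> \<beta>
    using arc_cases[OF that(1)] arc_cases[OF that(2)]
    by (elim disjE exE conjE; simp only:) (auto intro: FF MM FM FG MG GG intro: ok_sym[THEN iffD1])
  then show ?thesis
    unfolding noncrossing_D_def using D only must_up must_lo unfolding ok_def by blast
qed

section \<open>Attaching the largest element\<close>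

text \<open>
The set \<open>X\<close> holds the element joined to \<open>n\<close> from below, if any, and \<open>Y\<close> the element joined to
\<open>- n\<close>; the arc \<open>(n, - n)\<close> is encoded by \<open>n \<in> Y\<close>.
\<close>

definition attachments :: "nat \<Rightarrow> int set \<Rightarrow> bool \<Rightarrow> bool \<Rightarrow> (int set \<times> int set) set" where
  "attachments n U opens closes = {(X, Y).
     X \<subseteq> U \<and> Y \<subseteq> U \<union> {int n} \<and> X \<inter> Y = {} \<and>
     (if closes then is_singleton X else X = {}) \<and> (if opens then is_singleton Y else Y = {}) \<and>
     (int n \<in> Y \<longrightarrow> closes) \<and> even (card (U - X - Y)) \<and>
     (\<forall>x\<in>X \<union> Y - {int n}. separates (U - X - Y) x)}"

definition attach_F :: "nat \<Rightarrow> (int \<times> int) set \<Rightarrow> int set \<Rightarrow> (int \<times> int) set" where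
  "attach_F n M X = M \<union> X \<times> {int n}"

definition attach_G :: "nat \<Rightarrow> int set \<Rightarrow> int set \<Rightarrow> (int \<times> int) set" where
  "attach_G n K Y = reversal K \<union> Y \<times> {int n} \<union> {int n} \<times> Y"

text \<open>
Below \<open>n\<close>, the arcs of \<open>F\<close> form a last-in-first-out matching and those of \<open>G\<close> an order reversal, so
the pair is determined by the elements attached to \<open>n\<close> and \<open>- n\<close>.
\<close>

lemma noncrossing_halves_attached:
  assumes H: "half_arcs n F G" and NC: "noncrossing_halves n F G"
    and Op: "Domain F \<union> Domain G = Op" and Cl: "Range F = Cl"
  defines "M \<equiv> {(a, b) \<in> F. b < int n}"
  defines "U \<equiv> Op - {int n} - Domain M"
  shows "stack_matching (Op - {int n}) (Cl - {int n}) M"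
    and "\<exists>(X, Y) \<in> attachments n U (int n \<in> Op) (int n \<in> Cl).
           F = attach_F n M X \<and> G = attach_G n (U - X - Y) Y"
proof -
  note h = half_arcsD[OF H]
  show "stack_matching (Op - {int n}) (Cl - {int n}) M"
    unfolding stack_matching_def
  proof (intro conjI)
    show "M \<subseteq> {(i, j). i < j}" using h(1) by (auto simp: M_def)
    show "Domain M \<subseteq> Op - {int n}" using h(1) Op by (force simp: M_def)
    show "Range M = Cl - {int n}" using h(1) Cl by (force simp: M_def)
    show "single_valued M" "single_valued (M\<inverse>)"
      using h(4,5) by (auto simp: M_def single_valued_def)
    have "well_nested Op M" using NC Op by (simp add: noncrossing_halves_def M_def)
    then show "well_nested (Op - {int n}) M" unfolding well_nested_def by blast
  qed
  define X where "X = {x. (x, int n) \<in> F}"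
  define Y where "Y = {y. (y, int n) \<in> G}"
  have OpI: "a \<in> Op" if "(a, b) \<in> F \<or> (a, b) \<in> G" for a b using that Op by blast
  have X: "X \<subseteq> U"
  proof
    fix x assume x: "x \<in> X"
    then have "x < int n" "x \<in> Op" using h(1) OpI by (auto simp: X_def)
    moreover have "x \<notin> Domain M" using x h(4) by (fastforce simp: X_def M_def)
    ultimately show "x \<in> U" by (simp add: U_def)
  qed
  have Y: "Y \<subseteq> U \<union> {int n}"
  proof
    fix y assume y: "y \<in> Y"
    then have "y \<in> Op" "y \<notin> Domain M" using OpI h(8) by (auto simp: Y_def M_def)
    then show "y \<in> U \<union> {int n}" by (simp add: U_def)
  qed
  have disj: "X \<inter> Y = {}" using h(8) by (auto simp: X_def Y_def)
  have X1: "if int n \<in> Cl then is_singleton X else X = {}"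
  proof (cases "int n \<in> Cl")
    case True
    then obtain x where "(x, int n) \<in> F" using Cl by blast
    then have "X = {x}" using h(5) by (auto simp: X_def)
    then show ?thesis using True by (simp add: is_singleton_def)
  qed (use Cl in \<open>auto simp: X_def\<close>)
  have Y1: "if int n \<in> Op then is_singleton Y else Y = {}"
  proof (cases "int n \<in> Op")
    case True
    moreover have "int n \<notin> Domain F" using h(1)[of "int n"] by force
    ultimately obtain y where "(int n, y) \<in> G" using Op by blast
    then have "(y, int n) \<in> G" by (rule h(3))
    then have "Y = {y}" using h(7) by (auto simp: Y_def)
    then show ?thesis using True by (simp add: is_singleton_def)
  qed (use Op h(3) in \<open>auto simp: Y_def\<close>)
  have nY: "int n \<in> Y \<longrightarrow> int n \<in> Cl"
    using noncrossing_halvesD(3)[OF NC] Cl by (auto simp: Y_def)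
  have K: "Domain (core n G) = U - X - Y"
  proof (intro equalityI subsetI)
    fix i assume "i \<in> Domain (core n G)"
    then obtain j where ij: "(i, j) \<in> G" "i < int n" "j < int n" by (auto simp: core_def)
    then show "i \<in> U - X - Y" using OpI[of i j] h(8)[of i _ j] h(6)[of i j "int n"]
      by (auto simp: U_def X_def Y_def M_def)
  next
    fix u assume u: "u \<in> U - X - Y"
    have "u \<notin> Domain F"
    proof
      assume "u \<in> Domain F"
      then obtain b where b: "(u, b) \<in> F" by blast
      then have "b < int n" using u h(1)[OF b] by (cases "b = int n") (auto simp: X_def)
      then show False using b u by (auto simp: U_def M_def)
    qed
    then obtain j where j: "(u, j) \<in> G" using u Op by (auto simp: U_def)
    then have "j \<noteq> int n" "u \<noteq> int n" using u by (auto simp: Y_def U_def)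
    then show "u \<in> Domain (core n G)" using j h(2)[OF j] by (auto simp: core_def)
  qed
  have sep: "\<forall>x\<in>X \<union> Y - {int n}. separates (U - X - Y) x"
  proof
    fix x assume "x \<in> X \<union> Y - {int n}"
    then have "(x, int n) \<in> F \<union> G \<and> x \<noteq> int n" by (auto simp: X_def Y_def)
    moreover have "\<forall>x. (x, int n) \<in> F \<union> G \<and> x \<noteq> int n \<longrightarrow> separates (Domain (core n G)) x"
      using NC unfolding noncrossing_halves_def by blast
    ultimately show "separates (U - X - Y) x" unfolding K by blast
  qed
  have "(X, Y) \<in> attachments n U (int n \<in> Op) (int n \<in> Cl)"
    unfolding attachments_def
    using X Y disj X1 Y1 nY sep core_eq_reversal(2)[OF H NC, unfolded K] by blast
  moreover have "(a, b) \<in> F \<longleftrightarrow> (a, b) \<in> attach_F n M X" for a b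
    using h(1)[of a b] by (cases "b = int n") (auto simp: attach_F_def M_def X_def)
  then have "F = attach_F n M X" by auto
  moreover have "(i, j) \<in> G \<longleftrightarrow> (i, j) \<in> core n G \<union> Y \<times> {int n} \<union> {int n} \<times> Y" for i j
    using h(2)[of i j] h(3)[of i j] h(3)[of j i]
    by (cases "i = int n"; cases "j = int n") (auto simp: core_def Y_def)
  then have "G = attach_G n (U - X - Y) Y"
    unfolding attach_G_def using core_eq_reversal(1)[OF H NC, unfolded K] by auto
  ultimately show "\<exists>(X, Y) \<in> attachments n U (int n \<in> Op) (int n \<in> Cl).
      F = attach_F n M X \<and> G = attach_G n (U - X - Y) Y" by blast
qed

lemma attached_noncrossing_halves:
  assumes M: "stack_matching (Op - {int n}) (Cl - {int n}) M"
    and sub: "Op \<subseteq> {1..int n}" "Cl \<subseteq> {1..int n}"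
  defines "U \<equiv> Op - {int n} - Domain M"
  assumes XY: "(X, Y) \<in> attachments n U (int n \<in> Op) (int n \<in> Cl)"
  defines "F \<equiv> attach_F n M X" and "G \<equiv> attach_G n (U - X - Y) Y"
  shows "half_arcs n F G" and "noncrossing_halves n F G"
    and "Domain F \<union> Domain G = Op" and "Range F = Cl"
proof -
  define K where "K = U - X - Y"
  have X: "X \<subseteq> U" and Y: "Y \<subseteq> U \<union> {int n}" and disj: "X \<inter> Y = {}"
    and X1: "if int n \<in> Cl then is_singleton X else X = {}"
    and Y1: "if int n \<in> Op then is_singleton Y else Y = {}"
    and nY: "int n \<in> Y \<longrightarrow> int n \<in> Cl" and ev: "even (card K)"
    and sep: "\<forall>x\<in>X \<union> Y - {int n}. separates K x"
    using XY unfolding attachments_def K_def by blast+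
  have X_eq: "x = x'" if "x \<in> X" "x' \<in> X" for x x'
    using X1 that by (auto simp: is_singleton_def split: if_splits)
  have Y_eq: "y = y'" if "y \<in> Y" "y' \<in> Y" for y y'
    using Y1 that by (auto simp: is_singleton_def split: if_splits)
  have X_iff: "X \<noteq> {} \<longleftrightarrow> int n \<in> Cl"
    using X1 by (auto simp: is_singleton_def split: if_splits)
  have Y_iff: "Y \<noteq> {} \<longleftrightarrow> int n \<in> Op"
    using Y1 by (auto simp: is_singleton_def split: if_splits)
  have Op'_bounds: "0 < a \<and> a < int n" if "a \<in> Op - {int n}" for a
    using that sub(1) by force
  have M_sub: "Domain M \<subseteq> Op - {int n}" and M_range: "Range M = Cl - {int n}"
    and M_less: "M \<subseteq> {(i, j). i < j}" and M_sv: "single_valued M" "single_valued (M\<inverse>)"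
    and M_nest: "well_nested (Op - {int n}) M"
    using M by (auto simp: stack_matching_def)
  have M_bounds: "0 < a \<and> a < b \<and> b < int n" if "(a, b) \<in> M" for a b
  proof -
    have "a \<in> Op - {int n}" "b \<in> Cl - {int n}" using M_sub M_range that by blast+
    then have "b < int n" using sub(2) by force
    then show ?thesis using M_less that Op'_bounds[OF \<open>a \<in> Op - {int n}\<close>] by auto
  qed
  have U_bounds: "0 < u \<and> u < int n" if "u \<in> U" for u
    using that Op'_bounds by (simp add: U_def)
  have U_notin: "(u, b) \<notin> M" if "u \<in> U" for u b using that by (auto simp: U_def)
  have fin: "finite K"
    by (rule finite_subset[of _ "{1..int n}"]) (use sub in \<open>auto simp: K_def U_def\<close>)
  have K: "0 < u \<and> u < int n \<and> u \<in> U \<and> u \<notin> X \<and> u \<notin> Y" if "u \<in> K" for u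
    using that U_bounds by (simp add: K_def)
  have revK: "i \<in> K \<and> j \<in> K" if "(i, j) \<in> reversal K" for i j
    using that by (simp add: reversal_def)
  have F_iff: "(a, b) \<in> F \<longleftrightarrow> (a, b) \<in> M \<or> a \<in> X \<and> b = int n" for a b
    by (auto simp: F_def attach_F_def)
  have G_iff: "(i, j) \<in> G \<longleftrightarrow> (i, j) \<in> reversal K \<or> i \<in> Y \<and> j = int n \<or> i = int n \<and> j \<in> Y" for i j
    by (auto simp: G_def attach_G_def K_def)
  have Y_bounds: "0 < y \<and> y \<le> int n" if "y \<in> Y" for y
    using subsetD[OF Y that] U_bounds[of y] sub(1) Y_iff that by force
  have n_notin: "int n \<notin> K" "int n \<notin> X" "(a, int n) \<notin> M" "(int n, a) \<notin> M" for a
    using K X U_bounds M_bounds[of a "int n"] M_bounds[of "int n" a] by force+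
  show H: "half_arcs n F G"
    unfolding half_arcs_def
  proof (intro conjI)
    show "F \<subseteq> {(i, j). 0 < i \<and> i < j \<and> j \<le> int n}"
    proof clarify
      fix a b assume "(a, b) \<in> F"
      then show "0 < a \<and> a < b \<and> b \<le> int n"
        using M_bounds[of a b] X U_bounds[of a] by (auto simp: F_iff)
    qed
    show "G \<subseteq> {1..int n} \<times> {1..int n}"
    proof clarify
      fix i j assume "(i, j) \<in> G"
      then show "i \<in> {1..int n} \<and> j \<in> {1..int n}"
        using revK[of i j] K[of i] K[of j] Y_bounds[of i] Y_bounds[of j] by (auto simp: G_iff)
    qed
    show "sym G" using sym_reversal[OF fin] by (auto simp: sym_def G_iff)
    show "single_valued F"
    proof (rule single_valuedI)
      fix x y z assume "(x, y) \<in> F" "(x, z) \<in> F"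
      then show "y = z" using X U_notin single_valuedD[OF M_sv(1), of x y z] by (auto simp: F_iff)
    qed
    show "single_valued (F\<inverse>)"
    proof (rule single_valuedI)
      fix x y z assume "(x, y) \<in> F\<inverse>" "(x, z) \<in> F\<inverse>"
      then show "y = z" using X_eq n_notin single_valuedD[OF M_sv(2), of x y z] by (auto simp: F_iff)
    qed
    show "single_valued G"
    proof (rule single_valuedI)
      fix x y z assume "(x, y) \<in> G" "(x, z) \<in> G"
      then show "y = z"
        using Y_eq n_notin revK K[of x] single_valuedD[OF single_valued_reversal[OF fin], of x y z]
        by (auto simp: G_iff)
    qed
    have "a \<notin> Domain G" if "a \<in> Domain F" for a
    proof -
      have "a \<in> Domain M \<or> a \<in> X" using that by (auto simp: F_iff)
      then have "a \<noteq> int n \<and> a \<notin> K \<and> a \<notin> Y"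
        using n_notin K disj Y M_sub by (auto simp: U_def)
      then show ?thesis using revK by (auto simp: G_iff)
    qed
    then show "Domain F \<inter> Domain G = {}" by blast
  qed
  have "(i, j) \<in> core n G \<longleftrightarrow> (i, j) \<in> reversal K" for i j
    using revK[of i j] K[of i] K[of j] by (auto simp: core_def G_iff)
  then have core: "core n G = reversal K" by auto
  have "Domain F = Domain M \<union> X"
    by (auto simp: F_def attach_F_def)
  moreover have "Domain G = K \<union> Y \<union> (if Y = {} then {} else {int n})"
    unfolding G_def attach_G_def K_def[symmetric] Domain_Un_eq Domain_reversal[OF fin] by auto
  moreover have "U = X \<union> K \<union> (Y - {int n})"
    using X Y by (auto simp: K_def U_def)
  moreover have "Op - {int n} = Domain M \<union> U"
    using M_sub by (auto simp: U_def)
  ultimately show Op: "Domain F \<union> Domain G = Op" using Y_iff by (auto split: if_splits)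
  have "Range F = Range M \<union> (if X = {} then {} else {int n})"
    by (auto simp: F_def attach_F_def)
  then show "Range F = Cl" using M_range X_iff by auto
  have M_eq: "{(a, b) \<in> F. b < int n} = M" using M_bounds by (auto simp: F_iff)
  show "noncrossing_halves n F G"
    unfolding noncrossing_halves_def core Domain_reversal[OF fin] Op M_eq
  proof (intro conjI allI impI)
    show "well_nested Op M"
    proof (rule well_nestedI)
      fix a b c assume "(a, b) \<in> M" "c \<in> Op" "a < c" "c < b"
      moreover from this have "c \<in> Op - {int n}" using M_bounds[of a b] by auto
      ultimately show "\<exists>d<b. (c, d) \<in> M" using well_nestedD[OF M_nest] by metis
    qed
    show "i = int n" if "(i, i) \<in> G" for i
      using that reversal_fixed_point_iff[OF fin] ev by (auto simp: G_iff)
    show "int n \<in> Range F" if "(int n, int n) \<in> G"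
      using that revK n_notin nY \<open>Range F = Cl\<close> by (auto simp: G_iff)
    show "\<forall>(i, j) \<in> reversal K. \<forall>(i', j') \<in> reversal K. \<not> (i < i' \<and> j < j')"
      using reversal_decreasing[OF fin] by blast
    show "separates K x" if "(x, int n) \<in> F \<union> G \<and> x \<noteq> int n" for x
      using that sep n_notin revK by (auto simp: F_iff G_iff)
  qed
qed

lemma attach_inject:
  assumes M: "stack_matching (Op - {int n}) (Cl - {int n}) M"
    and U: "int n \<notin> U" and XY: "X \<subseteq> U" "X' \<subseteq> U"
    and F: "attach_F n M X = attach_F n M X'"
    and G: "attach_G n (U - X - Y) Y = attach_G n (U - X' - Y') Y'"
  shows "X = X' \<and> Y = Y'"
proof -
  have "int n \<notin> Range M" using M by (auto simp: stack_matching_def)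
  then have X: "X = {x. (x, int n) \<in> attach_F n M X}" for X by (auto simp: attach_F_def)
  have Y: "Y = {y. (y, int n) \<in> attach_G n (U - X - Y) Y}" for X Y
    using U by (auto simp: attach_G_def reversal_def)
  show ?thesis using X[of X] X[of X'] Y[of Y X] Y[of Y' X'] F G by simp
qed

section \<open>Counting the medians\<close>

lemma even_card_remove:
  assumes "finite U" "x \<in> U"
  shows "even (card (U - {x})) \<longleftrightarrow> odd (card U)"
  using card_Suc_Diff1[OF assms] by (metis even_Suc)

text \<open>
Removing \<open>x\<close> does not change the numbers of elements below and above \<open>x\<close>. Hence, if the
rest has even size, \<open>x\<close> separates it iff \<open>x\<close> is the median of \<open>U\<close>.
\<close>

lemma median_unique:
  assumes "finite U"
  defines "S \<equiv> {x \<in> U. even (card (U - {x})) \<and> separates (U - {x}) x}"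
  shows "odd (card U) \<Longrightarrow> is_singleton S" and "even (card U) \<Longrightarrow> S = {}"
proof -
  have S: "x \<in> S \<longleftrightarrow> odd (card U) \<and> below U x = card U div 2" if x: "x \<in> U" for x
  proof -
    have eq: "below (U - {x}) x = below U x" "above (U - {x}) x = above U x"
      unfolding below_def above_def by (auto intro!: arg_cong[where f = card])
    have "separates (U - {x}) x \<longleftrightarrow> below U x = above U x" if "odd (card U)"
      using separates_iff[of "U - {x}" x] that even_card_remove[OF assms(1) x] eq assms(1) by simp
    moreover have "below U x = above U x \<longleftrightarrow> below U x = card U div 2" if "odd (card U)"
      using below_above_in[OF assms(1) x] that by presburger
    ultimately show ?thesis using x even_card_remove[OF assms(1) x] by (auto simp: S_def)
  qed
  show "S = {}" if "even (card U)" using S that by (auto simp: S_def)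
  assume odd: "odd (card U)"
  then have "card U div 2 < card U" by (cases "card U") auto
  then obtain x where x: "x \<in> U" "below U x = card U div 2" using below_surj[OF assms(1)] by blast
  have "S = {x}"
  proof (intro equalityI subsetI)
    fix y assume y: "y \<in> S"
    then have "y \<in> U" by (simp add: S_def)
    then show "y \<in> {x}" using S[of y] y x below_inj[OF assms(1), of x y] by auto
  qed (use S[OF x(1)] x odd in auto)
  then show "is_singleton S" by (simp add: is_singleton_def)
qed

text \<open>
Let \<open>x < y\<close>. Removing both lowers the number of elements above \<open>x\<close> and below \<open>y\<close> by one. Hence,
if \<open>U\<close> has even size, they both separate the rest iff they are the two middle elements of \<open>U\<close>.
\<close>

lemma median_pairs:
  assumes fin: "finite U"
  defines "S \<equiv> {(x, y) \<in> U \<times> U. x \<noteq> y \<and> even (card (U - {x} - {y})) \<and>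
    separates (U - {x} - {y}) x \<and> separates (U - {x} - {y}) y}"
  shows "even (card U) \<Longrightarrow> U \<noteq> {} \<Longrightarrow> card S = 2" and "odd (card U) \<Longrightarrow> S = {}"
proof -
  have par: "even (card (U - {x} - {y})) \<longleftrightarrow> even (card U)" if "x \<in> U" "y \<in> U" "x \<noteq> y" for x y
    using even_card_remove[of "U - {x}" y] even_card_remove[of U x] fin that by auto
  show "S = {}" if "odd (card U)" using that par by (auto simp: S_def)
  assume ev: "even (card U)" and "U \<noteq> {}"
  have S_less: "(x, y) \<in> S \<longleftrightarrow> Suc (below U x) = card U div 2 \<and> below U y = card U div 2"
    if "x \<in> U" "y \<in> U" "x < y" for x y
  proof -
    define K where "K = U - {x} - {y}"
    have K: "finite K" "x \<notin> K" "y \<notin> K" "even (card K)"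
      using fin that ev par[of x y] by (auto simp: K_def)
    have "below K x = below U x" "above K y = above U y"
      unfolding below_def above_def K_def using that by (auto intro!: arg_cong[where f = card])
    moreover have "{u \<in> U. x < u} = insert y {u \<in> K. x < u}" "{u \<in> U. u < y} = insert x {u \<in> K. u < y}"
      using that by (auto simp: K_def)
    then have "above U x = Suc (above K x)" "below U y = Suc (below K y)"
      unfolding above_def below_def using K by simp_all
    ultimately have "separates K x \<longleftrightarrow> Suc (below U x) = above U x"
      "separates K y \<longleftrightarrow> below U y = Suc (above U y)"
      using separates_iff[OF K(1,4)] K(2,3) by auto
    moreover have "Suc (below U x) = above U x \<longleftrightarrow> Suc (below U x) = card U div 2"
      using below_above_in[OF fin that(1)] ev by presburger
    moreover have "below U y = Suc (above U y) \<longleftrightarrow> below U y = card U div 2"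
      using below_above_in[OF fin that(2)] ev by presburger
    ultimately show ?thesis using that K(4) by (auto simp: S_def K_def)
  qed
  have S_sym: "(y, x) \<in> S" if "(x, y) \<in> S" for x y
    using that by (auto simp: S_def Diff_insert2[symmetric] insert_commute)
  have "card U \<noteq> 0" using fin \<open>U \<noteq> {}\<close> by simp
  then have half: "card U div 2 - 1 < card U" "card U div 2 < card U" "0 < card U div 2"
    using ev by auto
  obtain p where p: "p \<in> U" "below U p = card U div 2 - 1" using below_surj[OF fin half(1)] by blast
  obtain q where q: "q \<in> U" "below U q = card U div 2" using below_surj[OF fin half(2)] by blast
  have pq: "p < q" using below_strict_mono[OF fin q(1), of p] p q half(3)
    by (cases p q rule: linorder_cases) auto
  have only: "x = p \<and> y = q" if "(x, y) \<in> S" "x < y" for x y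
  proof -
    have xy: "x \<in> U" "y \<in> U" using that(1) by (auto simp: S_def)
    then have "Suc (below U x) = card U div 2" "below U y = card U div 2" using S_less that by auto
    then show ?thesis using below_inj[OF fin] xy p q by (metis diff_Suc_1)
  qed
  have "S = {(p, q), (q, p)}"
  proof (intro equalityI subrelI)
    fix x y assume xy: "(x, y) \<in> S"
    then have "x \<noteq> y" by (auto simp: S_def)
    then show "(x, y) \<in> {(p, q), (q, p)}"
      using only[OF xy] only[OF S_sym[OF xy]] by (cases x y rule: linorder_cases) auto
  next
    have "(p, q) \<in> S" using S_less[OF p(1) q(1) pq] p q half(3) by simp
    then show "(x, y) \<in> {(p, q), (q, p)} \<Longrightarrow> (x, y) \<in> S" for x y using S_sym by blast
  qed
  then show "card S = 2" using pq by simp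
qed

text \<open>
In the application, \<open>d\<close> is the number of openers minus the number of closers.
\<close>

lemma attachments_count:
  fixes opens closes :: bool
  assumes fin: "finite U" and U: "int n \<notin> U" and ne: "closes \<Longrightarrow> U \<noteq> {}"
  defines "A \<equiv> attachments n U opens closes"
    and "d \<equiv> int (card U) + of_bool opens - of_bool closes"
  shows "odd d \<Longrightarrow> \<not> (opens \<and> closes) \<Longrightarrow> A = {}"
    and "even d \<noteq> (opens \<and> closes) \<Longrightarrow> card A = 1"
    and "even d \<Longrightarrow> opens \<Longrightarrow> closes \<Longrightarrow> card A = 2"
proof -
  define S1 where "S1 = {x \<in> U. even (card (U - {x})) \<and> separates (U - {x}) x}"
  define S2 where "S2 = {(x, y) \<in> U \<times> U. x \<noteq> y \<and> even (card (U - {x} - {y})) \<and>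
    separates (U - {x} - {y}) x \<and> separates (U - {x} - {y}) y}"
  note m1 = median_unique[OF fin, folded S1_def] and m2 = median_pairs[OF fin, folded S2_def]
  have card_S1: "card S1 = 1" if "odd (card U)" using m1(1)[OF that] by (simp add: is_singleton_altdef)
  have neither: "A = (if even (card U) then {({}, {})} else {})" if "\<not> opens" "\<not> closes"
    using that by (auto simp: A_def attachments_def)
  have ne_n: "x \<noteq> int n" if "x \<in> U" for x using that U by blast
  have only_closes: "A = (\<lambda>x. ({x}, {} :: int set)) ` S1" if oc: "\<not> opens" "closes"
  proof (intro equalityI subsetI)
    fix c assume "c \<in> A"
    then obtain x where "c = ({x}, {})" "x \<in> U" "even (card (U - {x}))" "separates (U - {x}) x"
      using oc ne_n by (auto simp: A_def attachments_def is_singleton_def)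
    then show "c \<in> (\<lambda>x. ({x}, {} :: int set)) ` S1" by (auto simp: S1_def)
  next
    fix c assume "c \<in> (\<lambda>x. ({x}, {} :: int set)) ` S1"
    then show "c \<in> A" using oc by (auto simp: A_def attachments_def S1_def)
  qed
  have only_opens: "A = (\<lambda>y. ({} :: int set, {y})) ` S1" if oc: "opens" "\<not> closes"
  proof (intro equalityI subsetI)
    fix c assume "c \<in> A"
    then obtain x where "c = ({}, {x})" "x \<in> U" "even (card (U - {x}))" "separates (U - {x}) x"
      using oc ne_n by (auto simp: A_def attachments_def is_singleton_def)
    then show "c \<in> (\<lambda>y. ({} :: int set, {y})) ` S1" by (auto simp: S1_def)
  next
    fix c assume "c \<in> (\<lambda>y. ({} :: int set, {y})) ` S1"
    then show "c \<in> A" using oc ne_n by (auto simp: A_def attachments_def S1_def)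
  qed
  have both: "A = (\<lambda>x. ({x}, {int n})) ` S1 \<union> (\<lambda>(x, y). ({x}, {y})) ` S2" if oc: "opens" "closes"
  proof (intro equalityI subsetI)
    fix c assume "c \<in> A"
    then obtain x y where xy: "c = ({x}, {y})"
      using oc by (auto simp: A_def attachments_def is_singleton_def)
    note A_xy = \<open>c \<in> A\<close>[unfolded xy A_def attachments_def mem_Collect_eq prod.case]
    have sub: "{x} \<subseteq> U \<and> {y} \<subseteq> U \<union> {int n} \<and> {x} \<inter> {y} = {}"
      using A_xy by (elim conjE, intro conjI)
    have ev: "even (card (U - {x} - {y}))" using A_xy by (elim conjE)
    have sep: "\<forall>z\<in>{x} \<union> {y} - {int n}. separates (U - {x} - {y}) z" using A_xy by (elim conjE)
    have c: "x \<in> U" "y \<in> U \<or> y = int n" "x \<noteq> y" using sub by auto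
    have "x \<noteq> int n" using c(1) U by blast
    show "c \<in> (\<lambda>x. ({x}, {int n})) ` S1 \<union> (\<lambda>(x, y). ({x}, {y})) ` S2"
    proof (cases "y = int n")
      case True
      then have "U - {x} - {y} = U - {x}" using U by auto
      then have "x \<in> S1" using c(1) ev sep \<open>x \<noteq> int n\<close> unfolding S1_def by auto
      then show ?thesis using xy True by blast
    next
      case False
      then have "(x, y) \<in> S2" using c ev sep \<open>x \<noteq> int n\<close> by (simp add: S2_def)
      then have "(\<lambda>(x, y). ({x}, {y})) (x, y) \<in> (\<lambda>(x, y). ({x}, {y})) ` S2" by (rule imageI)
      then show ?thesis using xy by simp
    qed
  next
    fix c assume "c \<in> (\<lambda>x. ({x}, {int n})) ` S1 \<union> (\<lambda>(x, y). ({x}, {y})) ` S2"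
    then consider x where "c = ({x}, {int n})" "x \<in> S1" | x y where "c = ({x}, {y})" "(x, y) \<in> S2" by auto
    then show "c \<in> A"
    proof cases
      case 1
      have x: "x \<in> U" "even (card (U - {x}))" "separates (U - {x}) x" using 1(2) unfolding S1_def by blast+
      have "U - {x} - {int n} = U - {x}" using U by auto
      moreover have "{x} \<union> {int n} - {int n} = {x}" "{x} \<inter> {int n} = {}" using x(1) U by auto
      ultimately show ?thesis
        unfolding 1(1) A_def attachments_def mem_Collect_eq prod.case
        using x oc by simp
    next
      case 2
      then show ?thesis using U oc by (auto simp: A_def attachments_def S2_def)
    qed
  qed
  show "A = {}" if "odd d" "\<not> (opens \<and> closes)"
  proof -
    consider "\<not> opens" "\<not> closes" | "\<not> opens" "closes" | "opens" "\<not> closes"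
      using \<open>\<not> (opens \<and> closes)\<close> by blast
    then show ?thesis
    proof cases
      case 1
      then show ?thesis using \<open>odd d\<close> neither by (simp add: d_def)
    next
      case 2
      then have "S1 = {}" using \<open>odd d\<close> m1(2) by (simp add: d_def)
      then show ?thesis using only_closes[OF 2] by simp
    next
      case 3
      then have "S1 = {}" using \<open>odd d\<close> m1(2) by (simp add: d_def)
      then show ?thesis using only_opens[OF 3] by simp
    qed
  qed
  show "card A = 1" if par: "even d \<noteq> (opens \<and> closes)"
  proof -
    consider "\<not> opens" "\<not> closes" | "\<not> opens" "closes" | "opens" "\<not> closes" | "opens" "closes" by blast
    then show ?thesis
    proof cases
      case 1
      then show ?thesis using par neither by (simp add: d_def)
    next
      case 2
      then have "card S1 = 1" using par card_S1 by (simp add: d_def)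
      then show ?thesis using only_closes[OF 2] by (simp add: card_image inj_on_def)
    next
      case 3
      then have "card S1 = 1" using par card_S1 by (simp add: d_def)
      then show ?thesis using only_opens[OF 3] by (simp add: card_image inj_on_def)
    next
      case 4
      then have "card S1 = 1" "S2 = {}" using par card_S1 m2(2) by (auto simp: d_def)
      then show ?thesis using both[OF 4] by (simp add: card_image inj_on_def)
    qed
  qed
  show "card A = 2" if "even d" opens closes
  proof -
    have "card S2 = 2" "S1 = {}" using that ne m1(2) m2(1) by (auto simp: d_def)
    moreover have "inj_on (\<lambda>(x, y). ({x}, {y})) S2" by (auto simp: inj_on_def)
    ultimately show ?thesis using both[OF that(2,3)] by (simp add: card_image)
  qed
qed

section \<open>Existence and number of non-crossing partitions\<close>

text \<open>
An attachment yields a pair of half arcs, which belongs to exactly one partition. Every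
non-crossing partition with the given openers and closers arises in this way, because the
matching below \<open>n\<close> is unique.
\<close>

lemma noncrossing_partitions_bij_attachments:
  assumes "n \<ge> 1" and sub: "Op \<subseteq> {1..int n}" "Cl \<subseteq> {1..int n}"
    and M: "stack_matching (Op - {int n}) (Cl - {int n}) M"
    and uniq: "\<And>M'. stack_matching (Op - {int n}) (Cl - {int n}) M' \<Longrightarrow> M' = M"
  defines "U \<equiv> Op - {int n} - Domain M"
  shows "\<exists>f. bij_betw f (attachments n U (int n \<in> Op) (int n \<in> Cl))
           {P. noncrossing_D n P \<and> openers P = Op \<and> closers P = Cl}"
proof -
  define A where "A = attachments n U (int n \<in> Op) (int n \<in> Cl)"
  define FG where "FG = (\<lambda>(X, Y). (attach_F n M X, attach_G n (U - X - Y) Y))"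
  define f where "f c = (SOME P. partition_on (pm_set n) P \<and> arcs P = case_prod sym_arcs (FG c))" for c
  have valid: "half_arcs n F G \<and> noncrossing_halves n F G \<and> Domain F \<union> Domain G = Op \<and> Range F = Cl"
    if "c \<in> A" "FG c = (F, G)" for c F G
  proof -
    obtain X Y where c: "c = (X, Y)" by fastforce
    then have "(X, Y) \<in> attachments n U (int n \<in> Op) (int n \<in> Cl)"
      using that(1) by (simp add: A_def)
    from attached_noncrossing_halves[OF M sub this[unfolded U_def], folded U_def]
    show ?thesis using that(2) by (simp add: FG_def c)
  qed
  have f: "partition_on (pm_set n) (f c) \<and> arcs (f c) = sym_arcs F G" if "c \<in> A" "FG c = (F, G)" for c F G
    using someI_ex[OF partition_of_half_arcs, of n F G] valid[OF that] that(2) by (simp add: f_def)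
  have "bij_betw f A {P. noncrossing_D n P \<and> openers P = Op \<and> closers P = Cl}"
  proof (rule bij_betw_imageI)
    show "inj_on f A"
    proof (rule inj_onI)
      fix c c' assume c: "c \<in> A" "c' \<in> A" "f c = f c'"
      obtain F G where FG1: "FG c = (F, G)" by fastforce
      obtain F' G' where FG2: "FG c' = (F', G')" by fastforce
      have "sym_arcs F G = sym_arcs F' G'" using f[OF c(1) FG1] f[OF c(2) FG2] c(3) by simp
      then have "F = F' \<and> G = G'"
        using valid[OF c(1) FG1] valid[OF c(2) FG2] sym_arcs_inject[of n F G F' G'] by simp
      moreover obtain X Y where XY: "c = (X, Y)" by fastforce
      moreover obtain X' Y' where XY': "c' = (X', Y')" by fastforce
      moreover have "int n \<notin> U" by (simp add: U_def)
      moreover have "X \<subseteq> U" "X' \<subseteq> U" using c XY XY' by (auto simp: A_def attachments_def)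
      ultimately show "c = c'"
        using attach_inject[OF M, of U X X' Y Y'] FG1 FG2 by (simp add: FG_def)
    qed
    show "f ` A = {P. noncrossing_D n P \<and> openers P = Op \<and> closers P = Cl}"
    proof (intro equalityI subsetI)
      fix P assume "P \<in> f ` A"
      then obtain c where c: "c \<in> A" "P = f c" by blast
      obtain F G where FG: "FG c = (F, G)" by fastforce
      note v = valid[OF c(1) FG] and g = f[OF c(1) FG]
      then have part: "partition_on (pm_set n) P" and H: "half_arcs n F G"
        and arcs: "arcs P = sym_arcs F G" and NC: "noncrossing_halves n F G"
        by (simp_all add: c(2))
      show "P \<in> {P. noncrossing_D n P \<and> openers P = Op \<and> closers P = Cl}"
        using noncrossing_D_if_noncrossing_halves[OF \<open>n \<ge> 1\<close> part H arcs NC]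
          openers_half_arcs[OF part H arcs] closers_half_arcs[OF part H arcs] v by simp
    next
      fix P assume "P \<in> {P. noncrossing_D n P \<and> openers P = Op \<and> closers P = Cl}"
      then have P: "noncrossing_D n P" "openers P = Op" "closers P = Cl" by auto
      then have part: "partition_on (pm_set n) P" and neg: "\<forall>B. B \<in> P \<longleftrightarrow> uminus ` B \<in> P"
        by (auto simp: noncrossing_D_def set_partition_D_def set_partition_C_def)
      then have "mirror (arcs P) = arcs P" using negated_blocks_iff_mirror_arcs[OF part] by simp
      then obtain F G where FG: "half_arcs n F G" "arcs P = sym_arcs F G"
        using half_arcs_of_partition[OF part] by blast
      have NC: "noncrossing_halves n F G"
        by (rule noncrossing_halves_if_noncrossing_D[OF \<open>n \<ge> 1\<close> part FG P(1)])
      have OC: "Domain F \<union> Domain G = Op" "Range F = Cl"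
        using openers_half_arcs[OF part FG] closers_half_arcs[OF part FG] P by auto
      have "{(a, b) \<in> F. b < int n} = M"
        by (rule uniq[OF noncrossing_halves_attached(1)[OF FG(1) NC OC]])
      then obtain c where c: "c \<in> A" "FG c = (F, G)"
        using noncrossing_halves_attached(2)[OF FG(1) NC OC] unfolding A_def FG_def U_def by auto
      have "0 \<notin> pm_set n" by (simp add: pm_set_iff)
      then have "P = f c"
        using partition_eq_if_arcs_eq[OF part conjunct1[OF f[OF c]] finite_pm_set] f[OF c] FG(2) by simp
      then show "P \<in> f ` A" using c(1) by blast
    qed
  qed
  then show ?thesis unfolding A_def by blast
qed

theorem proposition5p1:
  fixes n :: nat and Op Cl :: "int set"
  assumes "n \<ge> 1" and "opener_closer_config n Op Cl"
  shows "((\<exists>P. noncrossing_D n P \<and> openers P = Op \<and> closers P = Cl) \<longleftrightarrow>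
            even (int (card Op) - int (card Cl)) \<or> int n \<in> Op \<inter> Cl) \<and>
         (even (int (card Op) - int (card Cl)) \<and> int n \<in> Op \<inter> Cl \<longrightarrow>
            card {P. noncrossing_D n P \<and> openers P = Op \<and> closers P = Cl} = 2) \<and>
         (even (int (card Op) - int (card Cl)) \<noteq> (int n \<in> Op \<inter> Cl) \<longrightarrow>
            (\<exists>!P. noncrossing_D n P \<and> openers P = Op \<and> closers P = Cl))"
proof -
  define Op' where "Op' = Op - {int n}"
  define Cl' where "Cl' = Cl - {int n}"
  have sub: "Op \<subseteq> {1..int n}" "Cl \<subseteq> {1..int n}"
    and ballot: "\<And>k. k < n \<Longrightarrow> card (Cl \<inter> {1..int (k + 1)}) \<le> card (Op \<inter> {1..int k})"
    using opener_closer_configD[OF assms(2)] by blast+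
  have fin: "finite Op" "finite Cl" using sub by (auto intro: finite_subset)
  have interval: "{1..int (n - 1)} = {1..int n} - {int n}" using \<open>n \<ge> 1\<close> by auto
  have cut: "Op' \<inter> {1..int k} = Op \<inter> {1..int k}" "Cl' \<inter> {1..int k} = Cl \<inter> {1..int k}" if "k < n" for k
    using that by (auto simp: Op'_def Cl'_def)
  have config: "opener_closer_config (n - 1) Op' Cl'"
    unfolding opener_closer_config_def
  proof (intro conjI allI impI)
    show "Op' \<subseteq> {1..int (n - 1)}" "Cl' \<subseteq> {1..int (n - 1)}"
      unfolding interval using sub by (auto simp: Op'_def Cl'_def)
    show "card (Cl' \<inter> {1..int (k + 1)}) \<le> card (Op' \<inter> {1..int k})" if "k < n - 1" for k
      using ballot[of k] cut(1)[of k] cut(2)[of "k + 1"] that by simp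
  qed
  obtain M where M: "stack_matching Op' Cl' M"
    and uniq: "\<And>M'. stack_matching Op' Cl' M' \<Longrightarrow> M' = M"
    using stack_matching_ex1[OF config] by metis
  define U where "U = Op' - Domain M"
  have dom: "Domain M \<subseteq> Op'" "card (Domain M) = card Cl'"
    using M card_Domain_single_valued[of M] card_Range_single_valued[of M]
    by (auto simp: stack_matching_def)
  have fin': "finite Op'" "finite (Domain M)" using fin dom(1) by (auto simp: Op'_def intro: finite_subset)
  have card_U: "int (card U) = int (card Op') - int (card Cl')"
    unfolding U_def using card_Diff_subset[OF fin'(2) dom(1)] card_mono[OF fin'(1) dom(1)] dom(2) by simp
  have "int (card Op) = int (card Op') + of_bool (int n \<in> Op)"
    "int (card Cl) = int (card Cl') + of_bool (int n \<in> Cl)"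
    using fin card_Suc_Diff1[of Op "int n"] card_Suc_Diff1[of Cl "int n"]
    by (auto simp: Op'_def Cl'_def)
  then have d: "int (card U) + of_bool (int n \<in> Op) - of_bool (int n \<in> Cl) = int (card Op) - int (card Cl)"
    using card_U by simp
  \<comment> \<open>For \<open>k = n - 1\<close>, the hypothesis on the configuration leaves a partner for \<open>n\<close>.\<close>
  have ne: "U \<noteq> {}" if "int n \<in> Cl"
  proof -
    have "Op \<inter> {1..int (n - 1)} = Op'"
      unfolding interval using sub by (auto simp: Op'_def)
    moreover have "Cl \<inter> {1..int (n - 1 + 1)} = Cl" using sub \<open>n \<ge> 1\<close> by auto
    ultimately have "card Cl \<le> card Op'" using ballot[of "n - 1"] \<open>n \<ge> 1\<close> by simp
    moreover have "card Cl' < card Cl" unfolding Cl'_def using fin(2) that by (rule card_Diff1_less)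
    ultimately show ?thesis using card_U by auto
  qed
  have "int n \<notin> U" "finite U" using fin by (auto simp: U_def Op'_def)
  note count = attachments_count[OF \<open>finite U\<close> \<open>int n \<notin> U\<close> ne, of "int n \<in> Cl" "int n \<in> Op", unfolded d]
  let ?A = "attachments n U (int n \<in> Op) (int n \<in> Cl)"
  let ?S = "{P. noncrossing_D n P \<and> openers P = Op \<and> closers P = Cl}"
  have "\<exists>f. bij_betw f ?A ?S"
    unfolding U_def Op'_def
  proof (rule noncrossing_partitions_bij_attachments[OF \<open>n \<ge> 1\<close> sub])
    show "stack_matching (Op - {int n}) (Cl - {int n}) M" using M by (simp only: Op'_def Cl'_def)
    show "M' = M" if "stack_matching (Op - {int n}) (Cl - {int n}) M'" for M'
      using uniq that by (simp only: Op'_def Cl'_def)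
  qed
  then obtain f where f: "bij_betw f ?A ?S" by (elim exE)
  have card_S: "card ?S = card ?A" using bij_betw_same_card[OF f] by simp
  have empty: "?S = {}" if "odd (int (card Op) - int (card Cl))" "int n \<notin> Op \<inter> Cl"
  proof -
    have "?A = {}" using count(1) that by blast
    then show ?thesis using f by (simp add: bij_betw_def)
  qed
  have one: "card ?S = 1" if "even (int (card Op) - int (card Cl)) \<noteq> (int n \<in> Op \<inter> Cl)"
    using count(2) that card_S by simp
  have two: "card ?S = 2" if "even (int (card Op) - int (card Cl))" "int n \<in> Op \<inter> Cl"
    using count(3) that card_S by simp
  have unique: "\<exists>!P. P \<in> ?S" if par: "even (int (card Op) - int (card Cl)) \<noteq> (int n \<in> Op \<inter> Cl)"
  proof -
    obtain P where P: "?S = {P}" by (rule card_1_singletonE[OF one[OF par]])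
    show ?thesis unfolding P by blast
  qed
  have "(\<exists>P. P \<in> ?S) \<longleftrightarrow> even (int (card Op) - int (card Cl)) \<or> int n \<in> Op \<inter> Cl"
  proof
    show "\<exists>P. P \<in> ?S" if "even (int (card Op) - int (card Cl)) \<or> int n \<in> Op \<inter> Cl"
    proof -
      have "card ?S \<noteq> 0" using that one two by linarith
      then show ?thesis by (metis card.empty ex_in_conv)
    qed
  qed (use empty in blast)
  then show ?thesis using two unique by simp
qed

end
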